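(* Consider the MCSV problem: given $\mathcal{Y}=\{y_1,\ldots,y_N\}\subset\mathbb{R}^q$ and $\alpha\in(0,1)$, find a non-empty subset $\mathcal{C}\subseteq\mathcal{Y}$ of maximum cardinality such that $$\frac{1}{|\mathcal{C}|}\Big\|\sum_{y\in\mathcal{C}} y\Big\|^2 \le \alpha\,\frac{1}{|\mathcal{Y}|}\Big\|\sum_{y\in\mathcal{Y}} y\Big\|^2 ,$$ or report that no such subset exists. If all coordinates of the input vectors $y_1,\ldots,y_N$ are integers and each of them is at most $b$ in absolute value, then the MCSV problem is solvable (exactly) in $\mathcal{O}(qN(2bN+1)^q)$ time.
   Context: $\|\cdot\|$ denotes the Euclidean norm; $b$ is a positive integer bound on the absolute values of all coordinates of the input vectors. *)

theory Defs
  imports "HOL-Analysis.Analysis"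
begin

text \<open>
  Vectors of \<open>\<real>\<^sup>q\<close> are real lists of length \<open>q\<close>, because the dimension is part of the
  input of the algorithm and therefore has to be an ordinary variable.
\<close>

definition sum_norm :: "nat \<Rightarrow> real list set \<Rightarrow> real" where
  "sum_norm q C = L2_set (\<lambda>j. \<Sum>y\<in>C. y ! j) {..<q}"

definition mcsv_feasible :: "nat \<Rightarrow> real \<Rightarrow> real list set \<Rightarrow> real list set \<Rightarrow> bool" where
  "mcsv_feasible q \<alpha> Y C \<longleftrightarrow>
     C \<noteq> {} \<and> C \<subseteq> Y \<and>
     1 / real (card C) * (sum_norm q C)\<^sup>2 \<le> \<alpha> * (1 / real (card Y)) * (sum_norm q Y)\<^sup>2"

definition mcsv_optimal :: "nat \<Rightarrow> real \<Rightarrow> real list set \<Rightarrow> real list set \<Rightarrow> bool" where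
  "mcsv_optimal q \<alpha> Y C \<longleftrightarrow>
     mcsv_feasible q \<alpha> Y C \<and> (\<forall>D. mcsv_feasible q \<alpha> Y D \<longrightarrow> card D \<le> card C)"

text \<open>The answer \<open>None\<close> is the report that no subset is feasible.\<close>

fun mcsv_answer :: "nat \<Rightarrow> real \<Rightarrow> real list set \<Rightarrow> real list set option \<Rightarrow> bool" where
  "mcsv_answer q \<alpha> Y None \<longleftrightarrow> (\<nexists>C. mcsv_feasible q \<alpha> Y C)"
| "mcsv_answer q \<alpha> Y (Some C) \<longleftrightarrow> mcsv_optimal q \<alpha> Y C"


text \<open>
  Running time is measured on a structured real random access machine with uniform cost. A program
  is a command over finitely many named arrays of integers and finitely many named arrays of
  exact reals, each indexed by integers; a scalar variable is the cell with index 0. Nested array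
  accesses give indirect addressing.

  The instruction set is chosen so that unit cost is not an abuse: integers, the only values that
  can serve as addresses, are merely added, subtracted and compared (so they gain at most one bit
  per operation), and there is no rounding from reals to integers.
\<close>

type_synonym vname = string

type_synonym state = "(vname \<Rightarrow> int \<Rightarrow> int) \<times> (vname \<Rightarrow> int \<Rightarrow> real)"

datatype iexp =
    IConst int
  | IGet vname iexp
  | IPlus iexp iexp
  | IMinus iexp iexp

datatype rexp =
    ROfInt iexp
  | RGet vname iexp
  | RPlus rexp rexp
  | RMinus rexp rexp
  | RTimes rexp rexp
  | RDivide rexp rexp

datatype bexp =
    ILess iexp iexp
  | RLess rexp rexp
  | BNot bexp
  | BAnd bexp bexp

datatype com =
    Skip
  | ISet vname iexp iexp
  | RSet vname iexp rexp
  | Seq com com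
  | Cond bexp com com
  | While bexp com

fun ival :: "iexp \<Rightarrow> state \<Rightarrow> int" where
  "ival (IConst k) s = k"
| "ival (IGet x e) s = fst s x (ival e s)"
| "ival (IPlus e f) s = ival e s + ival f s"
| "ival (IMinus e f) s = ival e s - ival f s"

fun rval :: "rexp \<Rightarrow> state \<Rightarrow> real" where
  "rval (ROfInt e) s = real_of_int (ival e s)"
| "rval (RGet x e) s = snd s x (ival e s)"
| "rval (RPlus e f) s = rval e s + rval f s"
| "rval (RMinus e f) s = rval e s - rval f s"
| "rval (RTimes e f) s = rval e s * rval f s"
| "rval (RDivide e f) s = rval e s / rval f s"

fun bval :: "bexp \<Rightarrow> state \<Rightarrow> bool" where
  "bval (ILess e f) s = (ival e s < ival f s)"
| "bval (RLess e f) s = (rval e s < rval f s)"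
| "bval (BNot b) s = (\<not> bval b s)"
| "bval (BAnd b c) s = (bval b s \<and> bval c s)"

text \<open>
  Every constant, memory access, arithmetic or logical operation, comparison, assignment and
  branching costs one unit.
\<close>

fun icost :: "iexp \<Rightarrow> nat" where
  "icost (IConst k) = 1"
| "icost (IGet x e) = 1 + icost e"
| "icost (IPlus e f) = 1 + icost e + icost f"
| "icost (IMinus e f) = 1 + icost e + icost f"

fun rcost :: "rexp \<Rightarrow> nat" where
  "rcost (ROfInt e) = 1 + icost e"
| "rcost (RGet x e) = 1 + icost e"
| "rcost (RPlus e f) = 1 + rcost e + rcost f"
| "rcost (RMinus e f) = 1 + rcost e + rcost f"
| "rcost (RTimes e f) = 1 + rcost e + rcost f"
| "rcost (RDivide e f) = 1 + rcost e + rcost f"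

fun bcost :: "bexp \<Rightarrow> nat" where
  "bcost (ILess e f) = 1 + icost e + icost f"
| "bcost (RLess e f) = 1 + rcost e + rcost f"
| "bcost (BNot b) = 1 + bcost b"
| "bcost (BAnd b c) = 1 + bcost b + bcost c"

definition iupd :: "vname \<Rightarrow> int \<Rightarrow> int \<Rightarrow> state \<Rightarrow> state" where
  "iupd x i v s = ((fst s)(x := (fst s x)(i := v)), snd s)"

definition rupd :: "vname \<Rightarrow> int \<Rightarrow> real \<Rightarrow> state \<Rightarrow> state" where
  "rupd x i v s = (fst s, (snd s)(x := (snd s x)(i := v)))"

text \<open>\<open>runs c s n t\<close>: started in \<open>s\<close>, the program \<open>c\<close> halts in \<open>t\<close> at total cost \<open>n\<close>.\<close>

inductive runs :: "com \<Rightarrow> state \<Rightarrow> nat \<Rightarrow> state \<Rightarrow> bool" where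
  Skip: "runs Skip s 1 s"
| ISet: "runs (ISet x e f) s (1 + icost e + icost f) (iupd x (ival e s) (ival f s) s)"
| RSet: "runs (RSet x e f) s (1 + icost e + rcost f) (rupd x (ival e s) (rval f s) s)"
| Seq: "runs c s m t \<Longrightarrow> runs d t n u \<Longrightarrow> runs (Seq c d) s (m + n) u"
| IfTrue: "bval b s \<Longrightarrow> runs c s n t \<Longrightarrow> runs (Cond b c d) s (1 + bcost b + n) t"
| IfFalse: "\<not> bval b s \<Longrightarrow> runs d s n t \<Longrightarrow> runs (Cond b c d) s (1 + bcost b + n) t"
| WhileFalse: "\<not> bval b s \<Longrightarrow> runs (While b c) s (1 + bcost b) s"
| WhileTrue: "bval b s \<Longrightarrow> runs c s m t \<Longrightarrow> runs (While b c) t n u \<Longrightarrow>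
    runs (While b c) s (1 + bcost b + m + n) u"

inductive_cases runs_elims:
  "runs Skip s n t" "runs (ISet x e f) s n t" "runs (RSet x e f) s n t"
  "runs (Seq c d) s n t" "runs (Cond b c d) s n t" "runs (While b c) s n t"

lemma runs_deterministic:
  "runs c s n t \<Longrightarrow> runs c s m u \<Longrightarrow> m = n \<and> u = t"
proof (induction arbitrary: m u rule: runs.induct)
  case (Skip s) then show ?case by (auto elim: runs_elims(1))
next
  case (ISet x e f s) then show ?case by (auto elim: runs_elims(2))
next
  case (RSet x e f s) then show ?case by (auto elim: runs_elims(3))
next
  case Seq
  from Seq.prems show ?case by (rule runs_elims(4)) (metis Seq.IH plus_1_eq_Suc add_Suc)
next
  case IfTrue
  from IfTrue.prems show ?case by (rule runs_elims(5)) (metis IfTrue.IH IfTrue.hyps plus_1_eq_Suc add_Suc)+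
next
  case IfFalse
  from IfFalse.prems show ?case by (rule runs_elims(5)) (metis IfFalse.IH IfFalse.hyps plus_1_eq_Suc add_Suc)+
next
  case WhileFalse
  from WhileFalse.prems show ?case by (rule runs_elims(6)) (metis WhileFalse.hyps plus_1_eq_Suc add_Suc)+
next
  case WhileTrue
  from WhileTrue.prems show ?case by (rule runs_elims(6)) (metis WhileTrue.IH WhileTrue.hyps(1) plus_1_eq_Suc add_Suc)+
qed


text \<open>
  The input vectors are stored as reals, row by row: coordinate \<open>j\<close> of vector \<open>i\<close> is cell
  \<open>i * q + j\<close> of the array \<open>y\<close>. All memory not holding input is 0.
\<close>

definition mcsv_input :: "nat \<Rightarrow> real \<Rightarrow> real list list \<Rightarrow> state" where
  "mcsv_input q \<alpha> ys =
     ((\<lambda>_ _. 0)(''q'' := (\<lambda>_. 0)(0 := int q),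
                ''N'' := (\<lambda>_. 0)(0 := int (length ys))),
      (\<lambda>_ _. 0)(''alpha'' := (\<lambda>_. 0)(0 := \<alpha>),
                ''y'' := (\<lambda>k. if 0 \<le> k \<and> k < int (length ys * q)
                              then ys ! (nat k div q) ! (nat k mod q) else 0)))"

text \<open>
  The output is a flag \<open>found\<close> and, if it is nonzero, the indicator array \<open>C\<close> of the chosen
  vectors.
\<close>

definition mcsv_output :: "real list list \<Rightarrow> state \<Rightarrow> real list set option" where
  "mcsv_output ys s =
     (if fst s ''found'' 0 = 0 then None
      else Some {ys ! i |i. i < length ys \<and> fst s ''C'' (int i) \<noteq> 0})"

end

theory Submission
  imports Defs
begin

text \<open>
  Let \<open>B\<close> be the largest absolute value of a coordinate and \<open>W = 2BN + 1\<close>. Every subset sum has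
  coordinates of absolute value at most \<open>BN\<close>, so it is determined by its value in balanced base \<open>W\<close>,
  an integer of absolute value below \<open>M = W\<^sup>q\<close>; this encoding is additive. A dynamic program over
  the vectors tabulates, for each of the \<open>O(W\<^sup>q)\<close> codes, the largest cardinality of a subset whose sum
  has that code. All subsets with the same code have the same norm, so feasibility improves with the
  cardinality and only one subset per code has to be tested. It is recovered by backtracking, and its
  norm is computed in \<open>O(qN)\<close>, so no code ever needs to be decoded.
\<close>

section \<open>Reasoning about programs and their cost\<close>

text \<open>The machine shapes the program: integers can only be added, subtracted and compared,
  reals cannot be rounded, and \<open>b\<close> is not in memory. So \<open>B\<close>, the integer
  contributions of the coordinates, the base \<open>W\<close> and its powers are all produced by
  counting or repeated addition, at a cost linear in \<open>B\<close> or \<open>W\<close> per item.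
  This is affordable: B \<le> b and q \<ge> 1 give B, W \<le> (2bN + 1)^q. The base 2BN + 1 makes
  codes faithful because two column sums differ by at most 2BN, so the digits of a difference of
  codes stay below the base. The factor qN of the bound is spent on recomputing a norm from the
  original reals, at most once for each of the 2M + 1 codes in [-M, M]; filling a cell of the table
  takes constant time, so the table costs only O(NM).\<close>

definition wp :: "com \<Rightarrow> (nat \<Rightarrow> state \<Rightarrow> bool) \<Rightarrow> state \<Rightarrow> bool" where
  "wp c Q s \<longleftrightarrow> (\<exists>n t. runs c s n t \<and> Q n t)"

lemma wpI: "runs c s n t \<Longrightarrow> Q n t \<Longrightarrow> wp c Q s"
  unfolding wp_def by blast

lemma wpE:
  assumes "wp c Q s"
  obtains n t where "runs c s n t" "Q n t"
  using assms unfolding wp_def by blast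

lemma wp_mono: "wp c R s \<Longrightarrow> (\<And>n t. runs c s n t \<Longrightarrow> R n t \<Longrightarrow> Q n t) \<Longrightarrow> wp c Q s"
  unfolding wp_def by blast

text \<open>Because runs are unique, the existential in \<open>wp\<close> may be evaluated at any
  known run. This yields equations, hence simp rules, for the atomic commands.\<close>

lemma wp_runs: "runs c s n t \<Longrightarrow> wp c Q s = Q n t"
  unfolding wp_def by (metis runs_deterministic)

lemmas wp_Skip [simp] = wp_runs[OF runs.Skip]
  and wp_ISet [simp] = wp_runs[OF runs.ISet]
  and wp_RSet [simp] = wp_runs[OF runs.RSet]

lemma wp_Seq [simp]: "wp (Seq c d) Q s = wp c (\<lambda>m t. wp d (\<lambda>n u. Q (m + n) u) t) s"
  unfolding wp_def by (blast intro: runs.Seq elim: runs_elims(4))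

lemma wp_Cond [simp]:
  "wp (Cond b c d) Q s =
     (if bval b s then wp c (\<lambda>n t. Q (1 + bcost b + n) t) s else wp d (\<lambda>n t. Q (1 + bcost b + n) t) s)"
  unfolding wp_def
  by (cases "bval b s") (fastforce intro: runs.IfTrue runs.IfFalse elim: runs_elims(5))+

lemma fst_iupd [simp]: "fst (iupd x i v s) = (fst s)(x := (fst s x)(i := v))"
  and snd_iupd [simp]: "snd (iupd x i v s) = snd s"
  by (simp_all add: iupd_def)

lemma fst_rupd [simp]: "fst (rupd x i v s) = fst s"
  and snd_rupd [simp]: "snd (rupd x i v s) = (snd s)(x := (snd s x)(i := v))"
  by (simp_all add: rupd_def)

text \<open>A syntactic frame in terms of whole arrays, since the cells written depend on the state.
  Invariants then mention only the arrays that a loop body modifies.\<close>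

fun iwrites :: "com \<Rightarrow> vname set" where
  "iwrites Skip = {}"
| "iwrites (ISet x e f) = {x}"
| "iwrites (RSet x e f) = {}"
| "iwrites (Seq c d) = iwrites c \<union> iwrites d"
| "iwrites (Cond b c d) = iwrites c \<union> iwrites d"
| "iwrites (While b c) = iwrites c"

fun rwrites :: "com \<Rightarrow> vname set" where
  "rwrites Skip = {}"
| "rwrites (ISet x e f) = {}"
| "rwrites (RSet x e f) = {x}"
| "rwrites (Seq c d) = rwrites c \<union> rwrites d"
| "rwrites (Cond b c d) = rwrites c \<union> rwrites d"
| "rwrites (While b c) = rwrites c"

lemma runs_iframe: "runs c s n t \<Longrightarrow> x \<notin> iwrites c \<Longrightarrow> fst t x = fst s x"
  by (induction rule: runs.induct) auto

lemma runs_rframe: "runs c s n t \<Longrightarrow> x \<notin> rwrites c \<Longrightarrow> snd t x = snd s x"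
  by (induction rule: runs.induct) auto

text \<open>The invariant is indexed by the number of completed iterations. Reaching
  \<open>n\<close> gives termination, and the cost counts one guard per remaining iteration plus the
  final failing one.\<close>

lemma While_wp_aux:
  assumes step: "\<And>k t. k < n \<Longrightarrow> I k t \<Longrightarrow> bval b t \<and> wp c (\<lambda>m u. m \<le> B \<and> I (Suc k) u) t"
    and exit: "\<And>t. I n t \<Longrightarrow> \<not> bval b t"
    and "k \<le> n" "I k s"
  shows "wp (While b c) (\<lambda>m t. m \<le> 1 + bcost b + (n - k) * (1 + bcost b + B) \<and> I n t) s"
  using \<open>k \<le> n\<close> \<open>I k s\<close>
proof (induction "n - k" arbitrary: k s)
  case 0
  then have "k = n" by simp
  with 0 exit[of s] have "runs (While b c) s (1 + bcost b) s" by (metis runs.WhileFalse)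
  with 0 \<open>k = n\<close> show ?case by (auto intro: wpI)
next
  case (Suc d)
  then have "k < n" by simp
  from step[OF this Suc.prems(2)] obtain m u
    where u: "bval b s" "runs c s m u" "m \<le> B" "I (Suc k) u" by (auto elim: wpE)
  have "d = n - Suc k" "Suc k \<le> n" using Suc.hyps(2) \<open>k < n\<close> by simp_all
  from Suc.hyps(1)[OF this u(4)] obtain m' v
    where v: "runs (While b c) u m' v" "m' \<le> 1 + bcost b + (n - Suc k) * (1 + bcost b + B)" "I n v"
    by (auto elim: wpE)
  have "n - k = Suc (n - Suc k)" using \<open>k < n\<close> by simp
  then have "1 + bcost b + m + m' \<le> 1 + bcost b + (n - k) * (1 + bcost b + B)"
    using v(2) u(3) by simp
  with runs.WhileTrue[OF u(1,2) v(1)] v(3) show ?case by (blast intro: wpI)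
qed

lemma While_wp:
  assumes init: "I 0 s"
    and step: "\<And>k t. k < n \<Longrightarrow> (\<And>x. x \<notin> iwrites c \<Longrightarrow> fst t x = fst s x) \<Longrightarrow>
      (\<And>x. x \<notin> rwrites c \<Longrightarrow> snd t x = snd s x) \<Longrightarrow> I k t \<Longrightarrow>
      bval b t \<and> wp c (\<lambda>m u. m \<le> B \<and> I (Suc k) u) t"
    and exit: "\<And>t. (\<And>x. x \<notin> iwrites c \<Longrightarrow> fst t x = fst s x) \<Longrightarrow>
      (\<And>x. x \<notin> rwrites c \<Longrightarrow> snd t x = snd s x) \<Longrightarrow> I n t \<Longrightarrow> \<not> bval b t"
  shows "wp (While b c) (\<lambda>m t. m \<le> 1 + bcost b + n * (1 + bcost b + B) \<and> I n t) s"
proof -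
  define J where "J = (\<lambda>k t. I k t \<and> (\<forall>x. x \<notin> iwrites c \<longrightarrow> fst t x = fst s x) \<and>
    (\<forall>x. x \<notin> rwrites c \<longrightarrow> snd t x = snd s x))"
  have "wp (While b c) (\<lambda>m t. m \<le> 1 + bcost b + (n - 0) * (1 + bcost b + B) \<and> J n t) s"
  proof (rule While_wp_aux)
    fix k t assume k: "k < n" and J: "J k t"
    have "bval b t \<and> wp c (\<lambda>m u. m \<le> B \<and> I (Suc k) u) t"
      using J by (intro step k) (auto simp: J_def)
    then show "bval b t \<and> wp c (\<lambda>m u. m \<le> B \<and> J (Suc k) u) t"
      using J by (fastforce elim!: wp_mono simp: J_def dest: runs_iframe runs_rframe)
  next
    fix t assume "J n t"
    then show "\<not> bval b t" by (intro exit) (auto simp: J_def)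
  qed (use init in \<open>auto simp: J_def\<close>)
  then show ?thesis by (rule wp_mono) (auto simp: J_def)
qed

abbreviation IVar :: "vname \<Rightarrow> iexp" where "IVar x \<equiv> IGet x (IConst 0)"
abbreviation RVar :: "vname \<Rightarrow> rexp" where "RVar x \<equiv> RGet x (IConst 0)"
abbreviation IAsg :: "vname \<Rightarrow> iexp \<Rightarrow> com" where "IAsg x e \<equiv> ISet x (IConst 0) e"
abbreviation RAsg :: "vname \<Rightarrow> rexp \<Rightarrow> com" where "RAsg x e \<equiv> RSet x (IConst 0) e"

definition for_loop :: "vname \<Rightarrow> vname \<Rightarrow> com \<Rightarrow> com" where
  "for_loop i v c = Seq (IAsg i (IConst 0))
     (While (ILess (IVar i) (IVar v)) (Seq c (IAsg i (IPlus (IVar i) (IConst 1)))))"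

lemma iwrites_for_loop [simp]: "iwrites (for_loop i v c) = insert i (iwrites c)"
  and rwrites_for_loop [simp]: "rwrites (for_loop i v c) = rwrites c"
  by (auto simp: for_loop_def)

text \<open>The 12 consists of guard and branching (6) and the increment (6), the 9 of the
  initialization (3) and the last guard (6). The step obligation evaluates the invariant after the
  increment, whence the \<open>iupd\<close>.\<close>

lemma for_loop_wp:
  assumes v: "fst s v 0 = int n" "i \<notin> iwrites c" "v \<notin> iwrites c" "i \<noteq> v"
    and init: "I 0 (iupd i 0 0 s)"
    and step: "\<And>k t. k < n \<Longrightarrow> fst t i 0 = int k \<Longrightarrow>
      (\<And>x. x \<notin> insert i (iwrites c) \<Longrightarrow> fst t x = fst s x) \<Longrightarrow>
      (\<And>x. x \<notin> rwrites c \<Longrightarrow> snd t x = snd s x) \<Longrightarrow> I k t \<Longrightarrow>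
      wp c (\<lambda>m u. m \<le> B \<and> I (Suc k) (iupd i 0 (int k + 1) u)) t"
  shows "wp (for_loop i v c) (\<lambda>m t. m \<le> 9 + n * (B + 12) \<and> I n t) s"
proof -
  let ?b = "ILess (IVar i) (IVar v)"
  let ?c = "Seq c (IAsg i (IPlus (IVar i) (IConst 1)))"
  have "wp (While ?b ?c) (\<lambda>m t. m \<le> 1 + bcost ?b + n * (1 + bcost ?b + (B + 6)) \<and>
      (fst t i 0 = int n \<and> I n t)) (iupd i 0 0 s)"
  proof (rule While_wp)
    show "fst (iupd i 0 0 s) i 0 = int 0 \<and> I 0 (iupd i 0 0 s)" using init by simp
  next
    fix k t
    assume k: "k < n"
      and f: "\<And>x. x \<notin> iwrites ?c \<Longrightarrow> fst t x = fst (iupd i 0 0 s) x"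
        "\<And>x. x \<notin> rwrites ?c \<Longrightarrow> snd t x = snd (iupd i 0 0 s) x"
      and I: "fst t i 0 = int k \<and> I k t"
    have "wp c (\<lambda>m u. m \<le> B \<and> I (Suc k) (iupd i 0 (int k + 1) u)) t"
      by (rule step) (use k f I in auto)
    moreover have "fst u i 0 = int k" if "runs c t m u" for m u
      using runs_iframe[OF that v(2)] I by simp
    moreover have "fst t v 0 = int n" using f(1)[of v] v by simp
    ultimately show "bval ?b t \<and> wp ?c (\<lambda>m u. m \<le> B + 6 \<and> fst u i 0 = int (Suc k) \<and> I (Suc k) u) t"
      using k I by (auto elim!: wp_mono simp: add.commute)
  next
    fix t
    assume f: "\<And>x. x \<notin> iwrites ?c \<Longrightarrow> fst t x = fst (iupd i 0 0 s) x"
      and I: "fst t i 0 = int n \<and> I n t"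
    then show "\<not> bval ?b t" using f[of v] v by simp
  qed
  then show ?thesis
    unfolding for_loop_def by (simp, elim wp_mono) (auto simp: algebra_simps)
qed

section \<open>The recursion over the vectors\<close>

text \<open>The value 0 means that no subset has the code \<open>c\<close>; cardinalities are shifted by one.\<close>

fun best :: "(nat \<Rightarrow> int) \<Rightarrow> nat \<Rightarrow> int \<Rightarrow> int" where
  "best e 0 c = (if c = 0 then 1 else 0)"
| "best e (Suc i) c =
     (if 0 < best e i (c - e i) \<and> best e i c < best e i (c - e i) + 1
      then best e i (c - e i) + 1 else best e i c)"

text \<open>Membership of \<open>i\<close> is read off from two consecutive layers at the same code.
  The table of values thus suffices for backtracking, and no choices have to be stored.\<close>

fun best_set :: "(nat \<Rightarrow> int) \<Rightarrow> nat \<Rightarrow> int \<Rightarrow> nat set" where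
  "best_set e 0 c = {}"
| "best_set e (Suc i) c =
     (if best e i c < best e (Suc i) c then insert i (best_set e i (c - e i)) else best_set e i c)"

lemma best_set_subset: "best_set e i c \<subseteq> {..<i}"
proof (induction i arbitrary: c)
  case (Suc i)
  have "best_set e i c \<subseteq> {..<Suc i}" for c using Suc[of c] by auto
  then show ?case by auto
qed simp

lemma best_set_correct:
  "0 < best e i c \<Longrightarrow> int (card (best_set e i c)) + 1 = best e i c \<and> sum e (best_set e i c) = c"
proof (induction i arbitrary: c)
  case 0
  then show ?case by (simp split: if_splits)
next
  case (Suc i)
  have fin: "finite (best_set e i c')" "i \<notin> best_set e i c'" for c'
    using best_set_subset[of e i c'] finite_subset by auto
  show ?case
    using Suc.prems Suc.IH[of c] Suc.IH[of "c - e i"] fin by (auto split: if_splits)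
qed

text \<open>Optimal substructure: dropping the last index lowers the code by \<open>e i\<close> and
  the cardinality by one, and the recursion takes the maximum over both cases.\<close>

lemma best_ge: "I \<subseteq> {..<i} \<Longrightarrow> int (card I) + 1 \<le> best e i (sum e I)"
proof (induction i arbitrary: I)
  case 0
  then show ?case by simp
next
  case (Suc i)
  have fin: "finite I" using Suc.prems finite_subset by blast
  show ?case
  proof (cases "i \<in> I")
    case True
    have "int (card (I - {i})) + 1 \<le> best e i (sum e (I - {i}))"
      using Suc.prems by (intro Suc.IH) (auto simp: less_Suc_eq)
    moreover have "sum e (I - {i}) = sum e I - e i" "int (card (I - {i})) = int (card I) - 1"
      using True fin card.remove[of I i] by (simp_all add: sum_diff1)
    ultimately show ?thesis by auto
  next
    case False
    then have "I \<subseteq> {..<i}" using Suc.prems by (auto simp: less_Suc_eq)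
    then show ?thesis using Suc.IH[of I] by auto
  qed
qed

lemma best_nonneg: "0 \<le> best e i c"
  by (induction i arbitrary: c) auto

text \<open>A positive entry is witnessed by \<open>best_set\<close>, whose sum is the code itself.
  This is what allows a layer to be computed on \<open>{- M..M}\<close> only.\<close>

lemma best_outside:
  assumes "\<And>I. I \<subseteq> {..<n} \<Longrightarrow> \<bar>sum e I\<bar> \<le> M" "i \<le> n" "M < \<bar>c\<bar>"
  shows "best e i c = 0"
proof (rule ccontr)
  assume "best e i c \<noteq> 0"
  then have "sum e (best_set e i c) = c" using best_nonneg[of e i c] best_set_correct[of e i c] by simp
  moreover have "best_set e i c \<subseteq> {..<n}" using best_set_subset[of e i c] assms(2) by auto
  ultimately show False using assms(1)[of "best_set e i c"] assms(3) by simp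
qed

section \<open>Encoding integer vectors as integers\<close>

text \<open>Geometric series: digits of size at most W - 1 contribute at most (W - 1)(1 + W + ... +
  W^(q-1)) = W^q - 1.\<close>

lemma abs_digits_less:
  fixes W :: int
  assumes "\<And>j. j < q \<Longrightarrow> \<bar>f j\<bar> < W"
  shows "\<bar>\<Sum>j<q. f j * W ^ j\<bar> < W ^ q"
  using assms
proof (induction q)
  case (Suc q)
  have W: "0 < W" using Suc.prems[of 0] by simp
  have "\<bar>f q * W ^ q\<bar> \<le> (W - 1) * W ^ q"
    unfolding abs_mult using W Suc.prems[of q] by (intro mult_mono) auto
  moreover have "\<bar>\<Sum>j<q. f j * W ^ j\<bar> < W ^ q" using Suc by simp
  ultimately show ?case by (simp add: algebra_simps)
qed simp

lemma digits_zero: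
  fixes W :: int
  assumes "\<And>j. j < q \<Longrightarrow> \<bar>f j\<bar> < W" "(\<Sum>j<q. f j * W ^ j) = 0" "j < q"
  shows "f j = 0"
  using assms
proof (induction q)
  case (Suc q)
  have W: "0 < W" using Suc.prems(1)[of 0] by simp
  have "\<bar>\<Sum>j<q. f j * W ^ j\<bar> < W ^ q" using Suc.prems(1) by (intro abs_digits_less) simp
  \<comment> \<open>The total being 0, the leading term is the negative of the lower part, hence
    smaller than \<open>W ^ q\<close>.\<close>
  then have "\<bar>f q * W ^ q\<bar> < 1 * W ^ q" using Suc.prems(2) by simp
  then have "\<bar>f q\<bar> < 1" using W unfolding abs_mult by (simp add: mult_less_cancel_right)
  then have "f q = 0" by simp
  then show ?case using Suc by (cases "j = q") auto
qed simp

section \<open>The program\<close>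

text \<open>Comparing squares stands in for the absolute value of a real, which is not an
  instruction.\<close>

lemma of_int_square_less_iff:
  fixes a b :: int
  assumes "0 \<le> a"
  shows "real_of_int a * real_of_int a < real_of_int b * real_of_int b \<longleftrightarrow> a < \<bar>b\<bar>"
  using assms by (metis abs_mult_self_eq linorder_not_less mult_mono' mult_strict_mono'
          of_int_less_iff of_int_mult abs_ge_zero)

section \<open>Bounds, the base and its powers\<close>

definition p_size :: com where
  "p_size = Seq (IAsg ''L'' (IConst 0)) (for_loop ''i'' ''N'' (IAsg ''L'' (IPlus (IVar ''L'') (IVar ''q''))))"

lemma p_size_wp:
  assumes "fst s ''N'' 0 = int N" "fst s ''q'' 0 = int q"
  shows "wp p_size (\<lambda>m t. m \<le> 12 + N * 19 \<and> fst t ''L'' 0 = int (N * q)) s"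
proof -
  have "wp (for_loop ''i'' ''N'' (IAsg ''L'' (IPlus (IVar ''L'') (IVar ''q''))))
      (\<lambda>m t. m \<le> 9 + N * (7 + 12) \<and> fst t ''L'' 0 = int (N * q)) (iupd ''L'' 0 0 s)"
    by (rule for_loop_wp) (use assms in \<open>simp_all add: algebra_simps\<close>)
  then show ?thesis unfolding p_size_def by (auto elim: wp_mono)
qed

text \<open>The bound \<open>b\<close> is not part of the input, so the least admissible value is searched.\<close>

definition p_bound :: com where
  "p_bound = for_loop ''k'' ''L''
     (While (RLess (RTimes (ROfInt (IVar ''B'')) (ROfInt (IVar ''B'')))
                   (RTimes (RGet ''y'' (IVar ''k'')) (RGet ''y'' (IVar ''k''))))
        (IAsg ''B'' (IPlus (IVar ''B'') (IConst 1))))"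

text \<open>\<open>B\<close> grows only while some coordinate exceeds it, so it never passes
  \<open>b\<close>. Each cell is charged \<open>b\<close> increments of cost 22, a crude count that
  fits because Nqb is below the claimed bound.\<close>

lemma p_bound_wp:
  assumes "fst s ''L'' 0 = int L" "fst s ''B'' 0 = 0"
    and y: "\<And>k. k < L \<Longrightarrow> snd s ''y'' (int k) = real_of_int (y k)" "\<And>k. k < L \<Longrightarrow> \<bar>y k\<bar> \<le> int b"
  shows "wp p_bound (\<lambda>m t. m \<le> 9 + L * (b * 22 + 28) \<and>
    0 \<le> fst t ''B'' 0 \<and> fst t ''B'' 0 \<le> int b \<and> (\<forall>k<L. \<bar>y k\<bar> \<le> fst t ''B'' 0)) s"
proof -
  have "wp p_bound (\<lambda>m t. m \<le> 9 + L * ((b * 22 + 16) + 12) \<and>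
    (0 \<le> fst t ''B'' 0 \<and> fst t ''B'' 0 \<le> int b \<and> (\<forall>k<L. \<bar>y k\<bar> \<le> fst t ''B'' 0))) s"
    unfolding p_bound_def
  proof (rule for_loop_wp[where I = "\<lambda>k t. 0 \<le> fst t ''B'' 0 \<and> fst t ''B'' 0 \<le> int b \<and>
      (\<forall>k'<k. \<bar>y k'\<bar> \<le> fst t ''B'' 0)"])
    fix k and t :: state
    assume k: "k < L" "fst t ''k'' 0 = int k"
      and f: "\<And>x. x \<notin> rwrites (While (RLess (RTimes (ROfInt (IVar ''B'')) (ROfInt (IVar ''B'')))
                   (RTimes (RGet ''y'' (IVar ''k'')) (RGet ''y'' (IVar ''k''))))
        (IAsg ''B'' (IPlus (IVar ''B'') (IConst 1)))) \<Longrightarrow> snd t x = snd s x"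
      and I: "0 \<le> fst t ''B'' 0 \<and> fst t ''B'' 0 \<le> int b \<and> (\<forall>k'<k. \<bar>y k'\<bar> \<le> fst t ''B'' 0)"
    define B0 where "B0 = fst t ''B'' 0"
    \<comment> \<open>Increments still missing for this cell; \<open>nat\<close> makes it 0 when the
      current value already suffices.\<close>
    define n where "n = nat (\<bar>y k\<bar> - B0)"
    have yk: "snd t ''y'' (int k) = real_of_int (y k)" using f[of "''y''"] y(1)[OF k(1)] by simp
    let ?g = "RLess (RTimes (ROfInt (IVar ''B'')) (ROfInt (IVar ''B'')))
                   (RTimes (RGet ''y'' (IVar ''k'')) (RGet ''y'' (IVar ''k'')))"
    have "wp (While ?g (IAsg ''B'' (IPlus (IVar ''B'') (IConst 1))))
      (\<lambda>m u. m \<le> 1 + bcost ?g + n * (1 + bcost ?g + 6) \<and> fst u ''B'' 0 = B0 + int n) t"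
    proof (rule While_wp)
      fix j and u :: state
      assume "j < n" "fst u ''B'' 0 = B0 + int j"
        and f: "\<And>x. x \<notin> iwrites (IAsg ''B'' (IPlus (IVar ''B'') (IConst 1))) \<Longrightarrow> fst u x = fst t x"
         "\<And>x. x \<notin> rwrites (IAsg ''B'' (IPlus (IVar ''B'') (IConst 1))) \<Longrightarrow> snd u x = snd t x"
      then show "bval ?g u \<and> wp (IAsg ''B'' (IPlus (IVar ''B'') (IConst 1)))
         (\<lambda>m u. m \<le> 6 \<and> fst u ''B'' 0 = B0 + int (Suc j)) u"
        using f(1)[of "''k''"] f(2)[of "''y''"] k yk of_int_square_less_iff[of "B0 + int j" "y k"] I by (simp add: n_def B0_def)
    next
      fix u :: state
      assume "fst u ''B'' 0 = B0 + int n"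
        and f: "\<And>x. x \<notin> iwrites (IAsg ''B'' (IPlus (IVar ''B'') (IConst 1))) \<Longrightarrow> fst u x = fst t x"
         "\<And>x. x \<notin> rwrites (IAsg ''B'' (IPlus (IVar ''B'') (IConst 1))) \<Longrightarrow> snd u x = snd t x"
      then show "\<not> bval ?g u"
        using f(1)[of "''k''"] f(2)[of "''y''"] k yk of_int_square_less_iff[of "B0 + int n" "y k"] I by (simp add: n_def B0_def)
    qed (simp add: B0_def)
    moreover have "n \<le> b" "B0 + int n \<le> int b" "B0 \<le> B0 + int n" "\<bar>y k\<bar> \<le> B0 + int n"
      using y(2)[OF k(1)] I by (auto simp: n_def B0_def)
    ultimately show "wp (While ?g (IAsg ''B'' (IPlus (IVar ''B'') (IConst 1))))
      (\<lambda>m u. m \<le> b * 22 + 16 \<and> 0 \<le> fst (iupd ''k'' 0 (int k + 1) u) ''B'' 0 \<and>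
         fst (iupd ''k'' 0 (int k + 1) u) ''B'' 0 \<le> int b \<and>
         (\<forall>k'<Suc k. \<bar>y k'\<bar> \<le> fst (iupd ''k'' 0 (int k + 1) u) ''B'' 0)) t"
      using I by (elim wp_mono) (fastforce simp: less_Suc_eq B0_def)
  qed (use assms in auto)
  then show ?thesis by (simp add: add.assoc)
qed

definition p_base :: com where
  "p_base = Seq (IAsg ''W'' (IConst 1))
     (for_loop ''i'' ''N'' (IAsg ''W'' (IPlus (IPlus (IVar ''W'') (IVar ''B'')) (IVar ''B''))))"

lemma p_base_wp:
  assumes "fst s ''N'' 0 = int N" "fst s ''B'' 0 = int B"
  shows "wp p_base (\<lambda>m t. m \<le> 12 + N * 22 \<and> fst t ''W'' 0 = int (2 * B * N + 1)) s"
proof -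
  have "wp (for_loop ''i'' ''N'' (IAsg ''W'' (IPlus (IPlus (IVar ''W'') (IVar ''B'')) (IVar ''B''))))
      (\<lambda>m t. m \<le> 9 + N * (10 + 12) \<and> fst t ''W'' 0 = int (2 * B * N + 1)) (iupd ''W'' 0 1 s)"
    by (rule for_loop_wp) (use assms in \<open>simp_all add: algebra_simps\<close>)
  then show ?thesis unfolding p_base_def by (auto elim: wp_mono)
qed

definition p_pow :: com where
  "p_pow = Seq (ISet ''w'' (IConst 0) (IConst 1)) (for_loop ''j'' ''q''
     (Seq (IAsg ''a'' (IConst 0))
     (Seq (for_loop ''k'' ''W'' (IAsg ''a'' (IPlus (IVar ''a'') (IGet ''w'' (IVar ''j'')))))
          (ISet ''w'' (IPlus (IVar ''j'') (IConst 1)) (IVar ''a'')))))"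

lemma p_pow_wp:
  assumes "fst s ''q'' 0 = int q" "fst s ''W'' 0 = int W"
  shows "wp p_pow (\<lambda>m t. m \<le> 12 + q * (W * 20 + 40) \<and> (\<forall>j\<le>q. fst t ''w'' (int j) = int W ^ j)) s"
proof -
  let ?c = "IAsg ''a'' (IPlus (IVar ''a'') (IGet ''w'' (IVar ''j'')))"
  let ?b = "Seq (IAsg ''a'' (IConst 0)) (Seq (for_loop ''k'' ''W'' ?c)
          (ISet ''w'' (IPlus (IVar ''j'') (IConst 1)) (IVar ''a'')))"
  have "wp (for_loop ''j'' ''q'' ?b) (\<lambda>m t. m \<le> 9 + q * ((W * 20 + 28) + 12) \<and>
      (\<forall>j\<le>q. fst t ''w'' (int j) = int W ^ j)) (iupd ''w'' 0 1 s)"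
  proof (rule for_loop_wp)
    fix k and t :: state
    assume k: "k < q" "fst t ''j'' 0 = int k"
      and f: "\<And>x. x \<notin> insert ''j'' (iwrites ?b) \<Longrightarrow> fst t x = fst (iupd ''w'' 0 1 s) x"
      and I: "\<forall>j\<le>k. fst t ''w'' (int j) = int W ^ j"
    have "wp (for_loop ''k'' ''W'' ?c) (\<lambda>m t. m \<le> 9 + W * (8 + 12) \<and>
       fst t ''a'' 0 = int W * int W ^ k) (iupd ''a'' 0 0 t)"
    proof (rule for_loop_wp[where I = "\<lambda>l t. fst t ''a'' 0 = int l * int W ^ k"])
      fix l and u :: state
      assume f: "\<And>x. x \<notin> insert ''k'' (iwrites ?c) \<Longrightarrow> fst u x = fst (iupd ''a'' 0 0 t) x"
      and "fst u ''a'' 0 = int l * int W ^ k"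
      then show "wp ?c (\<lambda>m u. m \<le> 8 \<and> fst (iupd ''k'' 0 (int l + 1) u) ''a'' 0 = int (Suc l) * int W ^ k) u"
        using k I f[of "''j''"] f[of "''w''"] by (simp add: algebra_simps)
    qed (use f[of "''W''"] assms in simp_all)
    moreover have [simp]: "(int j = int k + 1) = (j = Suc k)" for j by auto
    ultimately show "wp ?b (\<lambda>m u. m \<le> W * 20 + 28 \<and>
       (\<forall>j\<le>Suc k. fst (iupd ''j'' 0 (int k + 1) u) ''w'' (int j) = int W ^ j)) t"
      unfolding wp_Seq wp_ISet
      using I k by (simp, elim wp_mono) (auto simp: runs_iframe le_Suc_eq)
  qed (use assms in simp_all)
  then show ?thesis unfolding p_pow_def by (simp, elim wp_mono) (simp add: add.commute)
qed

text \<open>A coordinate is converted to an integer by counting, which adds its multiple of \<open>W\<^sup>j\<close> on the way.\<close>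

definition p_digit :: com where
  "p_digit = While (RLess (RTimes (ROfInt (IVar ''z'')) (ROfInt (IVar ''z'')))
                          (RTimes (RGet ''y'' (IVar ''p'')) (RGet ''y'' (IVar ''p''))))
     (Seq (IAsg ''z'' (IPlus (IVar ''z'') (IConst 1)))
          (Cond (RLess (ROfInt (IConst 0)) (RGet ''y'' (IVar ''p'')))
             (ISet ''e'' (IVar ''i'') (IPlus (IGet ''e'' (IVar ''i'')) (IGet ''w'' (IVar ''j''))))
             (ISet ''e'' (IVar ''i'') (IMinus (IGet ''e'' (IVar ''i'')) (IGet ''w'' (IVar ''j''))))))"

lemma p_digit_wp:
  fixes v :: int and s :: state
  assumes "fst s ''z'' 0 = 0" "snd s ''y'' (fst s ''p'' 0) = real_of_int v" "\<bar>v\<bar> \<le> int B"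
    and i: "fst s ''i'' 0 = i" "fst s ''j'' 0 = j"
  shows "wp p_digit (\<lambda>m t. m \<le> 39 * B + 16 \<and>
    fst t ''e'' = (fst s ''e'')(i := fst s ''e'' i + v * fst s ''w'' j)) s"
proof -
  let ?g = "RLess (RTimes (ROfInt (IVar ''z'')) (ROfInt (IVar ''z'')))
                  (RTimes (RGet ''y'' (IVar ''p'')) (RGet ''y'' (IVar ''p'')))"
  let ?c = "Seq (IAsg ''z'' (IPlus (IVar ''z'') (IConst 1)))
          (Cond (RLess (ROfInt (IConst 0)) (RGet ''y'' (IVar ''p'')))
             (ISet ''e'' (IVar ''i'') (IPlus (IGet ''e'' (IVar ''i'')) (IGet ''w'' (IVar ''j''))))
             (ISet ''e'' (IVar ''i'') (IMinus (IGet ''e'' (IVar ''i'')) (IGet ''w'' (IVar ''j'')))))"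
  define n where "n = nat \<bar>v\<bar>"
  \<comment> \<open>Each count adds the weight with the sign of \<open>v\<close>; as
    \<open>sgn v * \<bar>v\<bar> = v\<close>, the exit value is the full contribution of the
    digit.\<close>
  define I where "I = (\<lambda>k (t :: state). fst t ''z'' 0 = int k \<and>
    fst t ''e'' = (fst s ''e'')(i := fst s ''e'' i + sgn v * int k * fst s ''w'' j))"
  have "wp p_digit (\<lambda>m t. m \<le> 1 + bcost ?g + n * (1 + bcost ?g + 23) \<and> I n t) s"
    unfolding p_digit_def
  proof (rule While_wp)
    show "I 0 s" using assms by (simp add: I_def)
  next
    fix k and t :: state
    assume k: "k < n"
      and f: "\<And>x. x \<notin> iwrites ?c \<Longrightarrow> fst t x = fst s x" "\<And>x. x \<notin> rwrites ?c \<Longrightarrow> snd t x = snd s x"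
      and I: "I k t"
    have "fst t ''p'' = fst s ''p''" "fst t ''i'' = fst s ''i''" "fst t ''j'' = fst s ''j''"
      "fst t ''w'' = fst s ''w''" "snd t ''y'' = snd s ''y''"
      by (simp_all add: f)
    then show "bval ?g t \<and> wp ?c (\<lambda>m u. m \<le> 23 \<and> I (Suc k) u) t"
      using k I assms of_int_square_less_iff[of "int k" v]
      by (auto simp: I_def n_def sgn_if algebra_simps)
  next
    fix t :: state
    assume f: "\<And>x. x \<notin> iwrites ?c \<Longrightarrow> fst t x = fst s x" "\<And>x. x \<notin> rwrites ?c \<Longrightarrow> snd t x = snd s x"
      and I: "I n t"
    then show "\<not> bval ?g t"
      using assms of_int_square_less_iff[of "int n" v] by (simp add: I_def n_def)
  qed
  moreover have "n \<le> B" "sgn v * int n = v" using assms by (auto simp: n_def sgn_if)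
  ultimately show ?thesis by (elim wp_mono) (auto simp: I_def)
qed

text \<open>The pointer \<open>p\<close> walks through the row-major array cell by cell, so the
  address i * q + j is never computed by multiplication.\<close>

definition p_code :: com where
  "p_code = Seq (IAsg ''p'' (IConst 0)) (for_loop ''i'' ''N'' (for_loop ''j'' ''q''
     (Seq (IAsg ''z'' (IConst 0)) (Seq p_digit (IAsg ''p'' (IPlus (IVar ''p'') (IConst 1)))))))"

lemma writes_p_digit [simp]: "iwrites p_digit = {''z'', ''e''}" "rwrites p_digit = {}"
  by (auto simp: p_digit_def)

lemma p_code_wp:
  fixes Y :: "nat \<Rightarrow> nat \<Rightarrow> int" and s :: state
  assumes "fst s ''N'' 0 = int N" "fst s ''q'' 0 = int q" "\<And>i. fst s ''e'' (int i) = 0"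
    and w: "\<And>j. j \<le> q \<Longrightarrow> fst s ''w'' (int j) = W ^ j"
    and y: "\<And>i j. i < N \<Longrightarrow> j < q \<Longrightarrow> snd s ''y'' (int (i * q + j)) = real_of_int (Y i j)"
      "\<And>i j. i < N \<Longrightarrow> j < q \<Longrightarrow> \<bar>Y i j\<bar> \<le> int B"
  shows "wp p_code (\<lambda>m t. m \<le> 12 + N * (21 + q * (39 * B + 37)) \<and>
    (\<forall>i<N. fst t ''e'' (int i) = (\<Sum>j<q. Y i j * W ^ j))) s"
proof -
  let ?b = "Seq (IAsg ''z'' (IConst 0)) (Seq p_digit (IAsg ''p'' (IPlus (IVar ''p'') (IConst 1))))"
  \<comment> \<open>Rows before \<open>i\<close> are complete, row \<open>i\<close> holds its first
    \<open>j\<close> digits, later rows are still 0. A completed row therefore already is the start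
    of the next one.\<close>
  define I where "I = (\<lambda>i j (t :: state). fst t ''p'' 0 = int (i * q + j) \<and>
    (\<forall>i'. fst t ''e'' (int i') = (if i' < i then \<Sum>l<q. Y i' l * W ^ l
       else if i' = i then \<Sum>l<j. Y i l * W ^ l else 0)))"
  have "wp (for_loop ''i'' ''N'' (for_loop ''j'' ''q'' ?b))
     (\<lambda>m t. m \<le> 9 + N * ((9 + q * ((39 * B + 25) + 12)) + 12) \<and> I N 0 t) (iupd ''p'' 0 0 s)"
  proof (rule for_loop_wp[where I = "\<lambda>i. I i 0"])
    fix i and t :: state
    assume i: "i < N" "fst t ''i'' 0 = int i"
      and f: "\<And>x. x \<notin> insert ''i'' (iwrites (for_loop ''j'' ''q'' ?b)) \<Longrightarrow> fst t x = fst (iupd ''p'' 0 0 s) x"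
        "\<And>x. x \<notin> rwrites (for_loop ''j'' ''q'' ?b) \<Longrightarrow> snd t x = snd (iupd ''p'' 0 0 s) x"
      and I: "I i 0 t"
    have ft: "fst t ''q'' = fst s ''q''" "fst t ''w'' = fst s ''w''" "snd t ''y'' = snd s ''y''"
      by (simp_all add: f)
    have "wp (for_loop ''j'' ''q'' ?b) (\<lambda>m u. m \<le> 9 + q * ((39 * B + 25) + 12) \<and> I i q u) t"
    proof (rule for_loop_wp)
      show "I i 0 (iupd ''j'' 0 0 t)" using I by (simp add: I_def)
    next
      fix j and u :: state
      assume j: "j < q" "fst u ''j'' 0 = int j"
        and f: "\<And>x. x \<notin> insert ''j'' (iwrites ?b) \<Longrightarrow> fst u x = fst t x"
          "\<And>x. x \<notin> rwrites ?b \<Longrightarrow> snd u x = snd t x"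
        and I: "I i j u"
      have fu: "fst u ''i'' = fst t ''i''" "fst u ''w'' = fst s ''w''" "snd u ''y'' = snd s ''y''"
        by (simp_all add: f ft)
      have p: "fst u ''p'' 0 = int (i * q + j)" using I by (simp add: I_def)
      have "wp p_digit (\<lambda>m t. m \<le> 39 * B + 16 \<and>
        fst t ''e'' = (fst u ''e'')(int i := fst u ''e'' (int i) + Y i j * W ^ j)) (iupd ''z'' 0 0 u)"
        using p_digit_wp[of "iupd ''z'' 0 0 u" "Y i j" B "int i" "int j"] i j fu p w[of j] y[OF i(1) j(1)]
        by simp
      then have "wp p_digit (\<lambda>m t. m \<le> 39 * B + 16 \<and>
        fst t ''e'' = (fst u ''e'')(int i := fst u ''e'' (int i) + Y i j * W ^ j) \<and>
        fst t ''p'' = fst u ''p'') (iupd ''z'' 0 0 u)"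
        by (rule wp_mono) (simp add: runs_iframe)
      then show "wp ?b (\<lambda>m u. m \<le> 39 * B + 25 \<and> I i (Suc j) (iupd ''j'' 0 (int j + 1) u)) u"
        using I by (simp, elim wp_mono) (auto simp: I_def)
    qed (use assms ft in simp_all)
    moreover have "I i q u \<Longrightarrow> I (Suc i) 0 (iupd ''i'' 0 (int i + 1) u)" for u
      by (auto simp: I_def less_Suc_eq algebra_simps)
    ultimately show "wp (for_loop ''j'' ''q'' ?b) (\<lambda>m u. m \<le> 9 + q * ((39 * B + 25) + 12) \<and>
       I (Suc i) 0 (iupd ''i'' 0 (int i + 1) u)) t"
      by (elim wp_mono) blast
  qed (use assms in \<open>simp_all add: I_def\<close>)
  then show ?thesis unfolding p_code_def by (simp, elim wp_mono) (auto simp: I_def algebra_simps)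
qed

text \<open>
  Layers are \<open>4 * M + 2\<close> cells apart, so that the reads at \<open>c - e i\<close>, which may leave \<open>{- M..M}\<close>,
  hit cells that are still 0 and never those of another layer.
\<close>

definition table_upto :: "(nat \<Rightarrow> int) \<Rightarrow> int \<Rightarrow> nat \<Rightarrow> (int \<Rightarrow> int) \<Rightarrow> bool" where
  "table_upto e M i T \<longleftrightarrow>
     (\<forall>r\<le>i. \<forall>c. \<bar>c\<bar> \<le> 2 * M \<longrightarrow> T (int r * (4 * M + 2) + c) = best e r c) \<and>
     (\<forall>x. int i * (4 * M + 2) + M < x \<longrightarrow> T x = 0)"

text \<open>The table while layer \<open>i + 1\<close> is being filled: \<open>k\<close> cells,
  starting at code -M, are written. The second clause also covers codes below -M, where memory and
  \<open>best\<close> both vanish.\<close>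

definition layer_upto :: "(nat \<Rightarrow> int) \<Rightarrow> int \<Rightarrow> nat \<Rightarrow> nat \<Rightarrow> (int \<Rightarrow> int) \<Rightarrow> bool" where
  "layer_upto e M i k T \<longleftrightarrow>
     (\<forall>r\<le>i. \<forall>c. \<bar>c\<bar> \<le> 2 * M \<longrightarrow> T (int r * (4 * M + 2) + c) = best e r c) \<and>
     (\<forall>c. - 2 * M \<le> c \<and> c < int k - M \<longrightarrow> T (int (Suc i) * (4 * M + 2) + c) = best e (Suc i) c) \<and>
     (\<forall>x \<ge> int (Suc i) * (4 * M + 2) + int k - M. T x = 0)"

text \<open>Memory is 0 beyond offset M from the center of layer \<open>i\<close>, and the window of
  the next layer starts at offset 2M + 2.\<close>

lemma layer_upto_0:
  assumes "table_upto e M i T" "0 \<le> M" "\<And>c. M < \<bar>c\<bar> \<Longrightarrow> best e (Suc i) c = 0"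
  shows "layer_upto e M i 0 T"
  using assms unfolding table_upto_def layer_upto_def by (auto simp: algebra_simps simp del: best.simps)

lemma layer_upto_Suc:
  assumes "layer_upto e M i k T" "int k \<le> 2 * M"
  shows "layer_upto e M i (Suc k)
    (T(int (Suc i) * (4 * M + 2) + int k - M := best e (Suc i) (int k - M)))"
proof -
  have "int r * (4 * M + 2) \<le> int i * (4 * M + 2)" if "r \<le> i" for r
    using that assms(2) by (intro mult_right_mono) auto
  \<comment> \<open>Earlier windows end at offset 2M from the center of layer \<open>i\<close>,
    whereas the new cell has offset at least 3M + 2.\<close>
  then have "int r * (4 * M + 2) + c \<noteq> int (Suc i) * (4 * M + 2) + int k - M"
    if "r \<le> i" "\<bar>c\<bar> \<le> 2 * M" for r c
    using that(2) assms(2) that(1)[THEN \<open>\<And>r. r \<le> i \<Longrightarrow> int r * (4 * M + 2) \<le> int i * (4 * M + 2)\<close>]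
    by (simp add: algebra_simps abs_le_iff)
  moreover have "c < int (Suc k) - M \<longleftrightarrow> c < int k - M \<or> c = int k - M" for c by auto
  moreover have "c + M = int k \<longrightarrow> best e (Suc i) (int k - M) = best e (Suc i) c" for c
    by (metis add_diff_cancel_right')
  ultimately show ?thesis
    using assms unfolding layer_upto_def by (simp add: algebra_simps del: best.simps)
qed

lemma layer_upto_end:
  assumes "layer_upto e M i k T" "int k = 2 * M + 1" "\<And>c. M < \<bar>c\<bar> \<Longrightarrow> best e (Suc i) c = 0"
  shows "table_upto e M (Suc i) T"
proof -
  have "T (int (Suc i) * (4 * M + 2) + c) = best e (Suc i) c" if "\<bar>c\<bar> \<le> 2 * M" for c
    using assms that unfolding layer_upto_def
    by (cases "c \<le> M") (auto simp: algebra_simps simp del: best.simps)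
  then show ?thesis
    using assms unfolding table_upto_def layer_upto_def by (auto simp: le_Suc_eq simp del: best.simps)
qed

lemma table_upto_0:
  assumes "0 \<le> M" "\<And>x. T x = (if x = 0 then 1 else 0)"
  shows "table_upto e M 0 T"
  using assms by (auto simp: table_upto_def)

section \<open>Filling the table\<close>

definition p_cell :: com where
  "p_cell = Seq (IAsg ''c'' (IMinus (IPlus (IVar ''h'') (IVar ''k'')) (IVar ''M'')))
     (Cond (BAnd (ILess (IConst 0) (IGet ''T'' (IMinus (IVar ''c'') (IGet ''e'' (IVar ''i'')))))
             (ILess (IGet ''T'' (IVar ''c'')) (IPlus (IGet ''T'' (IMinus (IVar ''c'') (IGet ''e'' (IVar ''i'')))) (IConst 1))))
       (ISet ''T'' (IPlus (IVar ''c'') (IVar ''D'')) (IPlus (IGet ''T'' (IMinus (IVar ''c'') (IGet ''e'' (IVar ''i'')))) (IConst 1)))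
       (ISet ''T'' (IPlus (IVar ''c'') (IVar ''D'')) (IGet ''T'' (IVar ''c''))))"

lemma writes_p_cell [simp]: "iwrites p_cell = {''c'', ''T''}" "rwrites p_cell = {}"
  by (auto simp: p_cell_def)

text \<open>The code and \<open>e i\<close> are at most M in absolute value, so both reads stay
  within 2M of the center and return entries of layer \<open>i\<close>. The write goes one stride
  \<open>D\<close> further, to the same code in layer \<open>i + 1\<close>.\<close>

lemma p_cell_wp:
  assumes "fst s ''h'' 0 = int i * (4 * M + 2)" "fst s ''M'' 0 = M" "fst s ''D'' 0 = 4 * M + 2"
    and "fst s ''i'' 0 = int i" "fst s ''k'' 0 = int k" "fst s ''e'' (int i) = e i"
    and k: "int k \<le> 2 * M" "\<bar>e i\<bar> \<le> M"
    and T: "layer_upto e M i k (fst s ''T'')"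
  shows "wp p_cell (\<lambda>m t. m \<le> 60 \<and> layer_upto e M i (Suc k) (fst t ''T'')) s"
proof -
  have read: "fst s ''T'' (int i * (4 * M + 2) + c) = best e i c" if "\<bar>c\<bar> \<le> 2 * M" for c
    using T that by (simp add: layer_upto_def)
  define x where "x = int i * (4 * M + 2) + int k - M"
  have "fst s ''T'' x = best e i (int k - M)" "fst s ''T'' (x - e i) = best e i (int k - M - e i)"
    using read[of "int k - M"] read[of "int k - M - e i"] k by (simp_all add: x_def algebra_simps)
  moreover have "layer_upto e M i (Suc k) ((fst s ''T'')(x + (4 * M + 2) := best e (Suc i) (int k - M)))"
    using layer_upto_Suc[OF T k(1)] by (simp add: x_def algebra_simps del: best.simps)
  moreover have "ival (IMinus (IPlus (IVar ''h'') (IVar ''k'')) (IVar ''M'')) s = x"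
    using assms by (simp add: x_def)
  ultimately show ?thesis
    using assms(2,3,4,6) unfolding p_cell_def wp_Seq wp_ISet by (auto split: if_splits)
qed

text \<open>The initial 1 is the entry of the empty subset. The stride 4M + 2 is twice the number 2M
  + 1 of codes, hence available by addition. At the end \<open>h\<close> is the center of the last
  layer, from which codes are looked up and traced.\<close>

definition p_table :: com where
  "p_table = Seq (ISet ''T'' (IConst 0) (IConst 1)) (Seq (IAsg ''h'' (IConst 0))
     (Seq (IAsg ''M'' (IGet ''w'' (IVar ''q'')))
     (Seq (IAsg ''V'' (IPlus (IPlus (IVar ''M'') (IVar ''M'')) (IConst 1)))
     (Seq (IAsg ''D'' (IPlus (IVar ''V'') (IVar ''V'')))
       (for_loop ''i'' ''N'' (Seq (for_loop ''k'' ''V'' p_cell)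
          (IAsg ''h'' (IPlus (IVar ''h'') (IVar ''D'')))))))))"

lemma p_table_wp:
  fixes s :: state
  assumes "fst s ''N'' 0 = int N" "fst s ''q'' 0 = int q" "fst s ''w'' (int q) = int M"
    and T: "\<And>x. fst s ''T'' x = 0" and e: "\<And>i. i < N \<Longrightarrow> fst s ''e'' (int i) = e i"
    and M: "\<And>I. I \<subseteq> {..<N} \<Longrightarrow> \<bar>sum e I\<bar> \<le> int M"
  shows "wp p_table (\<lambda>m t. m \<le> 36 + N * (28 + (2 * M + 1) * 72) \<and>
    table_upto e (int M) N (fst t ''T'') \<and> fst t ''h'' 0 = int N * (4 * int M + 2) \<and>
    fst t ''M'' 0 = int M \<and> fst t ''V'' 0 = 2 * int M + 1 \<and> fst t ''D'' 0 = 4 * int M + 2) s"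
proof -
  let ?s = "iupd ''D'' 0 (4 * int M + 2) (iupd ''V'' 0 (2 * int M + 1) (iupd ''M'' 0 (int M)
    (iupd ''h'' 0 0 (iupd ''T'' 0 1 s))))"
  let ?b = "Seq (for_loop ''k'' ''V'' p_cell) (IAsg ''h'' (IPlus (IVar ''h'') (IVar ''D'')))"
  define I where "I = (\<lambda>i (t :: state). fst t ''h'' 0 = int i * (4 * int M + 2) \<and>
    table_upto e (int M) i (fst t ''T''))"
  have "wp (for_loop ''i'' ''N'' ?b) (\<lambda>m t. m \<le> 9 + N * ((9 + (2 * M + 1) * (60 + 12) + 7) + 12) \<and> I N t) ?s"
  proof (rule for_loop_wp)
    show "I 0 (iupd ''i'' 0 0 ?s)" by (simp add: I_def table_upto_0 T)
  next
    fix i and t :: state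
    assume i: "i < N" "fst t ''i'' 0 = int i"
      and f: "\<And>x. x \<notin> insert ''i'' (iwrites ?b) \<Longrightarrow> fst t x = fst ?s x"
      and I: "I i t"
    have ft: "fst t ''V'' 0 = int (2 * M + 1)" "fst t ''M'' 0 = int M" "fst t ''D'' 0 = 4 * int M + 2"
      "fst t ''e'' = fst s ''e''"
      by (simp_all add: f)
    have out: "best e (Suc i) c = 0" if "int M < \<bar>c\<bar>" for c
      using that i by (intro best_outside[OF M]) auto
    have h: "fst t ''h'' 0 = int i * (4 * int M + 2)" using I by (simp add: I_def)
    have "wp (for_loop ''k'' ''V'' p_cell) (\<lambda>m t. m \<le> 9 + (2 * M + 1) * (60 + 12) \<and>
        layer_upto e (int M) i (2 * M + 1) (fst t ''T'')) t"
    proof (rule for_loop_wp[where I = "\<lambda>k t. layer_upto e (int M) i k (fst t ''T'')"])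
      show "layer_upto e (int M) i 0 (fst (iupd ''k'' 0 0 t) ''T'')"
        using I by (simp add: I_def layer_upto_0 out del: best.simps)
    next
      fix k and u :: state
      assume k: "k < 2 * M + 1" "fst u ''k'' 0 = int k"
        and f: "\<And>x. x \<notin> insert ''k'' (iwrites p_cell) \<Longrightarrow> fst u x = fst t x"
        and L: "layer_upto e (int M) i k (fst u ''T'')"
      have "wp p_cell (\<lambda>m t. m \<le> 60 \<and> layer_upto e (int M) i (Suc k) (fst t ''T'')) u"
      proof (rule p_cell_wp)
        show "\<bar>e i\<bar> \<le> int M" using M[of "{i}"] i by simp
      qed (use k L ft h i e in \<open>simp_all add: f\<close>)
      then show "wp p_cell (\<lambda>m u. m \<le> 60 \<and>
          layer_upto e (int M) i (Suc k) (fst (iupd ''k'' 0 (int k + 1) u) ''T'')) u"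
        by simp
    qed (use ft in simp_all)
    moreover have "layer_upto e (int M) i (2 * M + 1) T \<Longrightarrow> table_upto e (int M) (Suc i) T" for T
      by (rule layer_upto_end[where k = "2 * M + 1", OF _ _ out]) simp_all
    ultimately have "wp (for_loop ''k'' ''V'' p_cell) (\<lambda>m t. m \<le> 9 + (2 * M + 1) * (60 + 12) \<and>
        table_upto e (int M) (Suc i) (fst t ''T'')) t"
      by (elim wp_mono) blast
    then show "wp ?b (\<lambda>m u. m \<le> 9 + (2 * M + 1) * (60 + 12) + 7 \<and>
        I (Suc i) (iupd ''i'' 0 (int i + 1) u)) t"
      using h ft unfolding wp_Seq wp_ISet
      by (elim wp_mono) (simp add: I_def runs_iframe algebra_simps)
  qed (use assms in simp_all)
  moreover have "fst t x = fst ?s x" if "runs (for_loop ''i'' ''N'' ?b) ?s n t" "x \<in> {''M'', ''V'', ''D''}" for n t x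
    by (rule runs_iframe[OF that(1)]) (use that(2) in auto)
  ultimately have "wp (for_loop ''i'' ''N'' ?b) (\<lambda>m t. m \<le> 9 + N * (28 + (2 * M + 1) * 72) \<and>
    table_upto e (int M) N (fst t ''T'') \<and> fst t ''h'' 0 = int N * (4 * int M + 2) \<and>
    fst t ''M'' 0 = int M \<and> fst t ''V'' 0 = 2 * int M + 1 \<and> fst t ''D'' 0 = 4 * int M + 2) ?s"
    by (elim wp_mono) (simp add: I_def)
  moreover have "int M + int M + 1 = 2 * int M + 1" "2 * int M + 1 + (2 * int M + 1) = 4 * int M + 2"
    by simp_all
  ultimately show ?thesis
    unfolding p_table_def using assms(2,3) by (simp del: mult_2 add: numeral_eq_Suc)
qed

section \<open>Evaluating norms\<close>

definition p_norm :: com where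
  "p_norm = Seq (RAsg ''S'' (ROfInt (IConst 0))) (for_loop ''j'' ''q''
     (Seq (RAsg ''v'' (ROfInt (IConst 0))) (Seq (IAsg ''p'' (IVar ''j''))
     (Seq (for_loop ''i'' ''N'' (Seq
         (Cond (ILess (IConst 0) (IGet ''A'' (IVar ''i'')))
            (RAsg ''v'' (RPlus (RVar ''v'') (RGet ''y'' (IVar ''p'')))) Skip)
         (IAsg ''p'' (IPlus (IVar ''p'') (IVar ''q'')))))
       (RAsg ''S'' (RPlus (RVar ''S'') (RTimes (RVar ''v'') (RVar ''v''))))))))"

lemma writes_p_norm [simp]: "iwrites p_norm = {''j'', ''p'', ''i''}" "rwrites p_norm = {''S'', ''v''}"
  by (auto simp: p_norm_def)

text \<open>Column \<open>j\<close> is visited by advancing \<open>p\<close> in steps of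
  \<open>q\<close>. Feasibility mentions only squared norms, so no square root has to be
  taken.\<close>

lemma p_norm_wp:
  fixes s :: state
  assumes "fst s ''N'' 0 = int N" "fst s ''q'' 0 = int q"
  shows "wp p_norm (\<lambda>m t. m \<le> 13 + q * (39 + N * 33) \<and>
    snd t ''S'' 0 = (\<Sum>j<q. (\<Sum>i | i < N \<and> 0 < fst s ''A'' (int i). snd s ''y'' (int (i * q + j)))\<^sup>2)) s"
proof -
  let ?c = "Seq (Cond (ILess (IConst 0) (IGet ''A'' (IVar ''i'')))
            (RAsg ''v'' (RPlus (RVar ''v'') (RGet ''y'' (IVar ''p'')))) Skip)
         (IAsg ''p'' (IPlus (IVar ''p'') (IVar ''q'')))"
  let ?b = "Seq (RAsg ''v'' (ROfInt (IConst 0))) (Seq (IAsg ''p'' (IVar ''j''))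
     (Seq (for_loop ''i'' ''N'' ?c)
       (RAsg ''S'' (RPlus (RVar ''S'') (RTimes (RVar ''v'') (RVar ''v''))))))"
  let ?v = "\<lambda>n j. \<Sum>i | i < n \<and> 0 < fst s ''A'' (int i). snd s ''y'' (int (i * q + j))"
  have "wp (for_loop ''j'' ''q'' ?b) (\<lambda>m t. m \<le> 9 + q * ((27 + N * 33) + 12) \<and>
      snd t ''S'' 0 = (\<Sum>j<q. (?v N j)\<^sup>2)) (rupd ''S'' 0 0 s)"
  proof (rule for_loop_wp[where I = "\<lambda>j t. snd t ''S'' 0 = (\<Sum>l<j. (?v N l)\<^sup>2)"])
    fix j and t :: state
    assume j: "j < q" "fst t ''j'' 0 = int j"
      and f: "\<And>x. x \<notin> insert ''j'' (iwrites ?b) \<Longrightarrow> fst t x = fst (rupd ''S'' 0 0 s) x"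
        "\<And>x. x \<notin> rwrites ?b \<Longrightarrow> snd t x = snd (rupd ''S'' 0 0 s) x"
      and S: "snd t ''S'' 0 = (\<Sum>l<j. (?v N l)\<^sup>2)"
    have ft: "fst t ''N'' = fst s ''N''" "fst t ''q'' = fst s ''q''" "fst t ''A'' = fst s ''A''"
      "snd t ''y'' = snd s ''y''" by (simp_all add: f)
    let ?t = "iupd ''p'' 0 (int j) (rupd ''v'' 0 0 t)"
    have "wp (for_loop ''i'' ''N'' ?c) (\<lambda>m t. m \<le> 9 + N * (21 + 12) \<and>
       (fst t ''p'' 0 = int (N * q + j) \<and> snd t ''v'' 0 = ?v N j)) ?t"
    proof (rule for_loop_wp[where I = "\<lambda>n t. fst t ''p'' 0 = int (n * q + j) \<and> snd t ''v'' 0 = ?v n j"])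
      fix i and u :: state
      assume i: "i < N" "fst u ''i'' 0 = int i"
        and f: "\<And>x. x \<notin> insert ''i'' (iwrites ?c) \<Longrightarrow> fst u x = fst ?t x"
          "\<And>x. x \<notin> rwrites ?c \<Longrightarrow> snd u x = snd ?t x"
        and I: "fst u ''p'' 0 = int (i * q + j) \<and> snd u ''v'' 0 = ?v i j"
      have fu: "fst u ''q'' = fst s ''q''" "fst u ''A'' = fst s ''A''" "snd u ''y'' = snd s ''y''"
        by (simp_all add: f ft)
      have "{i'. i' < Suc i \<and> 0 < fst s ''A'' (int i')} =
        (if 0 < fst s ''A'' (int i) then insert i {i'. i' < i \<and> 0 < fst s ''A'' (int i')}
         else {i'. i' < i \<and> 0 < fst s ''A'' (int i')})"
        by (auto simp: less_Suc_eq)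
      then show "wp ?c (\<lambda>m u. m \<le> 21 \<and> fst (iupd ''i'' 0 (int i + 1) u) ''p'' 0 = int (Suc i * q + j) \<and>
          snd (iupd ''i'' 0 (int i + 1) u) ''v'' 0 = ?v (Suc i) j) u"
        using i I fu assms by (simp add: algebra_simps)
    qed (use assms ft in simp_all)
    then show "wp ?b (\<lambda>m u. m \<le> 27 + N * 33 \<and>
        snd (iupd ''j'' 0 (int j + 1) u) ''S'' 0 = (\<Sum>l<Suc j. (?v N l)\<^sup>2)) t"
      using S j by (simp, elim wp_mono) (simp add: runs_rframe power2_eq_square)
  qed (use assms in simp_all)
  then show ?thesis unfolding p_norm_def by simp
qed

definition p_total :: com where
  "p_total = Seq (for_loop ''i'' ''N'' (ISet ''A'' (IVar ''i'') (IConst 1))) (Seq p_norm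
     (RAsg ''g'' (RTimes (RTimes (RVar ''alpha'') (RDivide (ROfInt (IConst 1)) (ROfInt (IVar ''N''))))
       (RVar ''S''))))"

lemma writes_p_total [simp]: "iwrites p_total = {''A'', ''j'', ''p'', ''i''}" "rwrites p_total = {''S'', ''v'', ''g''}"
  by (auto simp: p_total_def)

text \<open>Selecting every index makes \<open>p_norm\<close> evaluate the full sum. The threshold
  \<open>g\<close> has the same form as in \<open>mcsv_feasible\<close>, and real arithmetic is
  exact.\<close>

lemma p_total_wp:
  fixes s :: state
  assumes "fst s ''N'' 0 = int N" "fst s ''q'' 0 = int q"
  shows "wp p_total (\<lambda>m t. m \<le> 36 + N * 16 + q * (39 + N * 33) \<and>
    snd t ''g'' 0 = snd s ''alpha'' 0 * (1 / real N) *
      (\<Sum>j<q. (\<Sum>i<N. snd s ''y'' (int (i * q + j)))\<^sup>2)) s"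
proof -
  let ?c = "ISet ''A'' (IVar ''i'') (IConst 1)"
  have "wp (for_loop ''i'' ''N'' ?c) (\<lambda>m t. m \<le> 9 + N * (4 + 12) \<and> (\<forall>i<N. fst t ''A'' (int i) = 1)) s"
    by (rule for_loop_wp) (use assms in \<open>auto simp: less_Suc_eq\<close>)
  then show ?thesis
    unfolding p_total_def wp_Seq wp_RSet
  proof (rule wp_mono)
    fix n t
    assume t: "runs (for_loop ''i'' ''N'' ?c) s n t"
      and A: "n \<le> 9 + N * (4 + 12) \<and> (\<forall>i<N. fst t ''A'' (int i) = 1)"
    have ft: "fst t ''N'' = fst s ''N''" "fst t ''q'' = fst s ''q''" "snd t ''y'' = snd s ''y''"
      "snd t ''alpha'' = snd s ''alpha''"
      by (simp_all add: runs_iframe[OF t] runs_rframe[OF t])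
    have "{i. i < N \<and> 0 < fst t ''A'' (int i)} = {..<N}" using A by auto
    then have "wp p_norm (\<lambda>m u. m \<le> 13 + q * (39 + N * 33) \<and>
      snd u ''S'' 0 = (\<Sum>j<q. (\<Sum>i<N. snd s ''y'' (int (i * q + j)))\<^sup>2)) t"
      using p_norm_wp[of t N q] assms ft by simp
    then show "wp p_norm (\<lambda>m u. n + (m + (1 + icost (IConst 0) + rcost (RTimes (RTimes (RVar ''alpha'') (RDivide (ROfInt (IConst 1)) (ROfInt (IVar ''N''))))
       (RVar ''S'')))) \<le> 36 + N * 16 + q * (39 + N * 33) \<and>
       snd (rupd ''g'' (ival (IConst 0) u) (rval (RTimes (RTimes (RVar ''alpha'') (RDivide (ROfInt (IConst 1)) (ROfInt (IVar ''N''))))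
       (RVar ''S'')) u) u) ''g'' 0 = snd s ''alpha'' 0 * (1 / real N) *
      (\<Sum>j<q. (\<Sum>i<N. snd s ''y'' (int (i * q + j)))\<^sup>2)) t"
      using A assms ft by (elim wp_mono) (simp add: runs_iframe runs_rframe)
  qed
qed

section \<open>Backtracking and selection\<close>

definition p_trace :: com where
  "p_trace = Seq (IAsg ''t'' (IMinus (IPlus (IVar ''h'') (IVar ''k'')) (IVar ''M'')))
     (for_loop ''r'' ''N''
       (Seq (IAsg ''i'' (IMinus (IMinus (IVar ''N'') (IVar ''r'')) (IConst 1)))
       (Seq (IAsg ''t'' (IMinus (IVar ''t'') (IVar ''D'')))
         (Cond (ILess (IGet ''T'' (IVar ''t'')) (IGet ''T'' (IPlus (IVar ''t'') (IVar ''D''))))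
           (Seq (ISet ''A'' (IVar ''i'') (IConst 1))
                (IAsg ''t'' (IMinus (IVar ''t'') (IGet ''e'' (IVar ''i'')))))
           (ISet ''A'' (IVar ''i'') (IConst 0))))))"

lemma writes_p_trace [simp]: "iwrites p_trace = {''t'', ''r'', ''i'', ''A''}" "rwrites p_trace = {}"
  by (auto simp: p_trace_def)

text \<open>Walking down the layers mirrors \<open>best_set\<close>: a strict increase from layer
  \<open>i\<close> to \<open>i + 1\<close> means that \<open>i\<close> was taken, and the code then
  drops by \<open>e i\<close>. Zeros are written explicitly because \<open>A\<close> may hold an
  earlier subset.\<close>

lemma p_trace_wp:
  fixes s :: state
  assumes "fst s ''N'' 0 = int N" "fst s ''h'' 0 = int N * (4 * M + 2)" "fst s ''M'' 0 = M"
    "fst s ''D'' 0 = 4 * M + 2" "fst s ''k'' 0 = int k"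
    and T: "table_upto e M N (fst s ''T'')" and e: "\<And>i. i < N \<Longrightarrow> fst s ''e'' (int i) = e i"
    and M: "\<And>I. I \<subseteq> {..<N} \<Longrightarrow> \<bar>sum e I\<bar> \<le> M"
    and pos: "0 < best e N (int k - M)" "int k \<le> 2 * M"
  shows "wp p_trace (\<lambda>m t. m \<le> 19 + N * 51 \<and>
    (\<forall>i<N. fst t ''A'' (int i) = of_bool (i \<in> best_set e N (int k - M)))) s"
proof -
  let ?b = "Seq (IAsg ''i'' (IMinus (IMinus (IVar ''N'') (IVar ''r'')) (IConst 1)))
       (Seq (IAsg ''t'' (IMinus (IVar ''t'') (IVar ''D'')))
         (Cond (ILess (IGet ''T'' (IVar ''t'')) (IGet ''T'' (IPlus (IVar ''t'') (IVar ''D''))))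
           (Seq (ISet ''A'' (IVar ''i'') (IConst 1))
                (IAsg ''t'' (IMinus (IVar ''t'') (IGet ''e'' (IVar ''i'')))))
           (ISet ''A'' (IVar ''i'') (IConst 0))))"
  let ?tr = "best_set e N (int k - M)"
  \<comment> \<open>The address \<open>t\<close> encodes the layer N - r together with a code
    \<open>c\<close>; the part of the target subset below N - r is exactly \<open>best_set\<close>
    there.\<close>
  define I where "I = (\<lambda>r (t :: state). \<exists>c. 0 < best e (N - r) c \<and>
    fst t ''t'' 0 = int (N - r) * (4 * M + 2) + c \<and> ?tr \<inter> {..<N - r} = best_set e (N - r) c \<and>
    (\<forall>i<N. N - r \<le> i \<longrightarrow> fst t ''A'' (int i) = of_bool (i \<in> ?tr)))"
  let ?s = "iupd ''t'' 0 (int N * (4 * M + 2) + int k - M) s"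
  have "wp (for_loop ''r'' ''N'' ?b) (\<lambda>m t. m \<le> 9 + N * (39 + 12) \<and> I N t) ?s"
  proof (rule for_loop_wp)
    show "I 0 (iupd ''r'' 0 0 ?s)"
      using pos best_set_subset[of e N "int k - M"] by (auto simp: I_def)
  next
    fix r and t :: state
    assume r: "r < N" "fst t ''r'' 0 = int r"
      and f: "\<And>x. x \<notin> insert ''r'' (iwrites ?b) \<Longrightarrow> fst t x = fst ?s x"
      and I: "I r t"
    define n where "n = N - Suc r"
    have n: "N - r = Suc n" "n < N" "N - Suc r = n" "int N - int r - 1 = int n"
      using r by (auto simp: n_def)
    from I obtain c where c: "0 < best e (Suc n) c"
      "fst t ''t'' 0 = int (Suc n) * (4 * M + 2) + c" "?tr \<inter> {..<Suc n} = best_set e (Suc n) c"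
      "\<And>i. i < N \<Longrightarrow> Suc n \<le> i \<Longrightarrow> fst t ''A'' (int i) = of_bool (i \<in> ?tr)"
      unfolding I_def n by blast
    have ft: "fst t ''N'' 0 = int N" "fst t ''D'' 0 = 4 * M + 2" "fst t ''T'' = fst s ''T''"
      "fst t ''e'' (int n) = e n"
      using assms n by (simp_all add: f)
    have "\<bar>c\<bar> \<le> M" using best_outside[OF M, where i = "Suc n" and c = c] c(1) n by (cases "\<bar>c\<bar> \<le> M") auto
    then have "\<bar>c\<bar> \<le> 2 * M" by simp
    then have read: "fst s ''T'' (int n * (4 * M + 2) + c) = best e n c"
      "fst s ''T'' (int n * (4 * M + 2) + c + (4 * M + 2)) = best e (Suc n) c"
      using T n(2) unfolding table_upto_def by (auto simp: algebra_simps dest: spec[of _ "Suc n"] simp del: best.simps)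
    have t: "fst t ''t'' 0 - (4 * M + 2) = int n * (4 * M + 2) + c" using c(2) by (simp add: algebra_simps)
    have top: "fst s ''T'' (fst t ''t'' 0) = best e (Suc n) c" using read(2) by (simp flip: t)
    have lo: "?tr \<inter> {..<n} = best_set e (Suc n) c - {n}" "n \<in> ?tr \<longleftrightarrow> n \<in> best_set e (Suc n) c"
      unfolding c(3)[symmetric] by auto
    have nt: "n \<notin> best_set e n c'" for c' using best_set_subset[of e n c'] by auto
    have I: "I (Suc r) u"
      if "fst u ''t'' 0 = int n * (4 * M + 2) + c'" "0 < best e n c'" "best_set e (Suc n) c - {n} = best_set e n c'"
        "fst u ''A'' = (fst t ''A'')(int n := of_bool (n \<in> best_set e (Suc n) c))" for u c'
      unfolding I_def n(3)
    proof (intro exI[of _ c'] conjI allI impI)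
      fix i assume "i < N" "n \<le> i"
      then show "fst u ''A'' (int i) = of_bool (i \<in> ?tr)"
        using c(4)[of i] lo(2) that(4) by (cases "i = n") (simp_all del: best_set.simps)
    qed (use that lo in \<open>simp_all del: best_set.simps best.simps\<close>)
    show "wp ?b (\<lambda>m u. m \<le> 39 \<and> I (Suc r) (iupd ''r'' 0 (int r + 1) u)) t"
    proof (cases "best e n c < best e (Suc n) c")
      case True
      then have "best_set e (Suc n) c = insert n (best_set e n (c - e n))" "0 < best e n (c - e n)"
        by (auto split: if_splits)
      then show ?thesis
        using True r ft read top t n nt
        by (simp del: best.simps best_set.simps)
          (intro I[of _ "c - e n"]; simp del: best.simps best_set.simps)
    next
      case False
      then have "best_set e (Suc n) c = best_set e n c" "0 < best e n c"
        using c(1) by (auto split: if_splits)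
      then show ?thesis
        using False r ft read top t n nt
        by (simp del: best.simps best_set.simps)
          (intro I[of _ "c"]; simp del: best.simps best_set.simps)
    qed
  qed (use assms in simp_all)
  then show ?thesis
    unfolding p_trace_def using assms(2,3,5) by (simp, elim wp_mono) (auto simp: I_def)
qed

text \<open>Only entries above the best so far are traced. As \<open>x\<close> starts at 1, the
  shifted cardinality of the empty subset, this also discards that subset and unattained codes and
  keeps \<open>m - 1\<close> away from 0. The copy to \<open>C\<close> is made because the next
  trace overwrites \<open>A\<close>.\<close>

definition p_check :: com where
  "p_check = Seq (IAsg ''m'' (IGet ''T'' (IMinus (IPlus (IVar ''h'') (IVar ''k'')) (IVar ''M''))))
     (Cond (ILess (IVar ''x'') (IVar ''m''))
       (Seq p_trace (Seq p_norm
         (Cond (RLess (RVar ''g'') (RTimes (RDivide (ROfInt (IConst 1)) (ROfInt (IMinus (IVar ''m'') (IConst 1)))) (RVar ''S'')))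
           Skip
           (Seq (IAsg ''found'' (IConst 1)) (Seq (IAsg ''x'' (IVar ''m''))
             (for_loop ''i'' ''N'' (ISet ''C'' (IVar ''i'') (IGet ''A'' (IVar ''i'')))))))))
       Skip)"

lemma writes_p_check [simp]:
  "iwrites p_check = {''m'', ''t'', ''r'', ''i'', ''A'', ''j'', ''p'', ''found'', ''x'', ''C''}"
  "rwrites p_check = {''S'', ''v''}"
  by (auto simp: p_check_def)

definition sq_norm :: "nat \<Rightarrow> (nat \<Rightarrow> nat \<Rightarrow> real) \<Rightarrow> nat set \<Rightarrow> real" where
  "sq_norm q y I = (\<Sum>j<q. (\<Sum>i\<in>I. y i j)\<^sup>2)"

definition admissible :: "nat \<Rightarrow> (nat \<Rightarrow> nat \<Rightarrow> real) \<Rightarrow> real \<Rightarrow> (nat \<Rightarrow> int) \<Rightarrow> nat \<Rightarrow> int \<Rightarrow> bool" where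
  "admissible q y g e N c \<longleftrightarrow> 1 < best e N c \<and>
     1 / real_of_int (best e N c - 1) * sq_norm q y (best_set e N c) \<le> g"

text \<open>\<open>K\<close> collects the codes examined so far; \<open>m\<close> is the largest
  shifted cardinality accepted, with 1 standing for none.\<close>

definition selected :: "nat \<Rightarrow> (nat \<Rightarrow> nat \<Rightarrow> real) \<Rightarrow> real \<Rightarrow> (nat \<Rightarrow> int) \<Rightarrow> nat \<Rightarrow> int set \<Rightarrow> int \<Rightarrow> state \<Rightarrow> bool" where
  "selected q y g e N K m s \<longleftrightarrow> 1 \<le> m \<and> (\<forall>c\<in>K. admissible q y g e N c \<longrightarrow> best e N c \<le> m) \<and>
     (if fst s ''found'' 0 = 0 then m = 1
      else \<exists>c\<in>K. admissible q y g e N c \<and> best e N c = m \<and>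
        (\<forall>i<N. fst s ''C'' (int i) = of_bool (i \<in> best_set e N c)))"

lemma p_check_wp:
  fixes s :: state and y :: "nat \<Rightarrow> nat \<Rightarrow> real"
  assumes N: "fst s ''N'' 0 = int N" "fst s ''q'' 0 = int q"
    and h: "fst s ''h'' 0 = int N * (4 * M + 2)" "fst s ''M'' 0 = M"
      "fst s ''D'' 0 = 4 * M + 2" "fst s ''k'' 0 = int k"
    and T: "table_upto e M N (fst s ''T'')" and e: "\<And>i. i < N \<Longrightarrow> fst s ''e'' (int i) = e i"
    and M: "\<And>I. I \<subseteq> {..<N} \<Longrightarrow> \<bar>sum e I\<bar> \<le> M"
    and k: "int k \<le> 2 * M"
    and g: "snd s ''g'' 0 = g"
    and y: "\<And>i j. i < N \<Longrightarrow> j < q \<Longrightarrow> snd s ''y'' (int (i * q + j)) = y i j"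
    and sel: "selected q y g e N K (fst s ''x'' 0) s"
  shows "wp p_check (\<lambda>m t. m \<le> 100 + N * 69 + q * (39 + N * 33) \<and>
    selected q y g e N (insert (int k - M) K) (fst t ''x'' 0) t) s"
proof -
  let ?c = "int k - M"
  let ?s = "iupd ''m'' 0 (best e N ?c) s"
  have "fst s ''T'' (int N * (4 * M + 2) + ?c) = best e N ?c"
    using T k unfolding table_upto_def by auto
  then have read: "fst s ''T'' (int N * (4 * M + 2) + int k - M) = best e N ?c"
    by (simp add: add_diff_eq)
  show ?thesis
  proof (cases "fst s ''x'' 0 < best e N ?c")
    case False
    \<comment> \<open>A skipped code has an entry of at most \<open>x\<close>, so the maximality
      clause extends to it whether or not it is admissible.\<close>
    then have "selected q y g e N (insert ?c K) (fst s ''x'' 0) ?s"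
      using sel unfolding selected_def by auto
    then show ?thesis using False h read unfolding p_check_def by simp
  next
    case True
    then have pos: "1 < best e N ?c" using sel by (simp add: selected_def)
    have "wp p_trace (\<lambda>m t. m \<le> 19 + N * 51 \<and>
      (\<forall>i<N. fst t ''A'' (int i) = of_bool (i \<in> best_set e N ?c))) ?s"
      by (rule p_trace_wp) (use assms pos in simp_all)
    then obtain n1 t1 where t1: "runs p_trace ?s n1 t1" "n1 \<le> 19 + N * 51"
      and A: "\<And>i. i < N \<Longrightarrow> fst t1 ''A'' (int i) = of_bool (i \<in> best_set e N ?c)"
      by (elim wpE) blast
    note f1 = runs_iframe[OF t1(1)] runs_rframe[OF t1(1)]
    have "wp p_norm (\<lambda>m t. m \<le> 13 + q * (39 + N * 33) \<and>
      snd t ''S'' 0 = (\<Sum>j<q. (\<Sum>i | i < N \<and> 0 < fst t1 ''A'' (int i). snd t1 ''y'' (int (i * q + j)))\<^sup>2)) t1"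
      by (rule p_norm_wp) (use N in \<open>simp_all add: f1\<close>)
    then obtain n2 t2 where t2: "runs p_norm t1 n2 t2" "n2 \<le> 13 + q * (39 + N * 33)"
      and S: "snd t2 ''S'' 0 = (\<Sum>j<q. (\<Sum>i | i < N \<and> 0 < fst t1 ''A'' (int i). snd t1 ''y'' (int (i * q + j)))\<^sup>2)"
      by (elim wpE) blast
    note f2 = runs_iframe[OF t2(1)] runs_rframe[OF t2(1)]
    have sub: "best_set e N ?c \<subseteq> {..<N}" by (rule best_set_subset)
    then have "{i. i < N \<and> 0 < fst t1 ''A'' (int i)} = best_set e N ?c" using A by auto
    then have S: "snd t2 ''S'' 0 = sq_norm q y (best_set e N ?c)"
      unfolding S sq_norm_def using sub
      by (auto intro!: sum.cong arg_cong[where f = "\<lambda>x. x\<^sup>2"] simp: f1 y simp del: of_nat_add of_nat_mult)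
    have f: "fst t2 ''m'' 0 = best e N ?c" "fst t2 ''x'' 0 = fst s ''x'' 0" "snd t2 ''g'' 0 = g"
      "fst t2 ''found'' = fst s ''found''" "fst t2 ''C'' = fst s ''C''" "fst t2 ''A'' = fst t1 ''A''"
      "fst t2 ''N'' 0 = int N"
      using g N by (simp_all add: f1 f2)
    let ?g = "RLess (RVar ''g'') (RTimes (RDivide (ROfInt (IConst 1)) (ROfInt (IMinus (IVar ''m'') (IConst 1)))) (RVar ''S''))"
    have b: "bval ?g t2 \<longleftrightarrow> \<not> admissible q y g e N ?c"
      using pos S f by (simp add: admissible_def not_le)
    let ?l = "for_loop ''i'' ''N'' (ISet ''C'' (IVar ''i'') (IGet ''A'' (IVar ''i'')))"
    let ?d = "Cond ?g Skip (Seq (IAsg ''found'' (IConst 1)) (Seq (IAsg ''x'' (IVar ''m'')) ?l))"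
    have "wp ?d (\<lambda>m t. m \<le> 40 + N * 18 \<and> selected q y g e N (insert ?c K) (fst t ''x'' 0) t) t2"
    proof (cases "admissible q y g e N ?c")
      case False
      then have "selected q y g e N (insert ?c K) (fst s ''x'' 0) t2"
        using sel f unfolding selected_def by auto
      then show ?thesis using False b f by (simp del: bval.simps)
    next
      case ok: True
      let ?t = "iupd ''x'' 0 (best e N ?c) (iupd ''found'' 0 1 t2)"
      have "wp ?l (\<lambda>m t. m \<le> 9 + N * (6 + 12) \<and> (\<forall>i<N. fst t ''C'' (int i) = fst t1 ''A'' (int i))) ?t"
      proof (rule for_loop_wp[where I = "\<lambda>n t. \<forall>i<n. fst t ''C'' (int i) = fst t1 ''A'' (int i)"])
        fix i and t :: state
        assume i: "i < N" "fst t ''i'' 0 = int i"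
          and fr: "\<And>x. x \<notin> insert ''i'' (iwrites (ISet ''C'' (IVar ''i'') (IGet ''A'' (IVar ''i'')))) \<Longrightarrow> fst t x = fst ?t x"
          and C: "\<forall>i'<i. fst t ''C'' (int i') = fst t1 ''A'' (int i')"
        have "fst t ''A'' = fst t1 ''A''" using f fr[of "''A''"] by simp
        then show "wp (ISet ''C'' (IVar ''i'') (IGet ''A'' (IVar ''i''))) (\<lambda>m u. m \<le> 6 \<and>
          (\<forall>i'<Suc i. fst (iupd ''i'' 0 (int i + 1) u) ''C'' (int i') = fst t1 ''A'' (int i'))) t"
          using i C by (auto simp: less_Suc_eq)
      qed (use f in simp_all)
      moreover have "selected q y g e N (insert ?c K) (fst t ''x'' 0) t"
        if "runs ?l ?t n t" "\<forall>i<N. fst t ''C'' (int i) = fst t1 ''A'' (int i)" for n t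
        using True ok sel pos that(2) A unfolding selected_def
        by (force simp: runs_iframe[OF that(1)])
      ultimately have "wp ?l (\<lambda>m t. m \<le> 9 + N * (6 + 12) \<and> selected q y g e N (insert ?c K) (fst t ''x'' 0) t) ?t"
        by (elim wp_mono) blast
      then show ?thesis
        using ok b f by (simp del: bval.simps, elim wp_mono) simp
    qed
    then obtain n3 t3 where t3: "runs ?d t2 n3 t3" "n3 \<le> 40 + N * 18"
      "selected q y g e N (insert ?c K) (fst t3 ''x'' 0) t3" by (elim wpE) blast
    have "runs (Seq p_trace (Seq p_norm ?d)) ?s (n1 + (n2 + n3)) t3"
      by (rule runs.Seq[OF t1(1) runs.Seq[OF t2(1) t3(1)]])
    then have "wp (Seq p_trace (Seq p_norm ?d)) (\<lambda>n t. n \<le> 72 + N * 69 + q * (39 + N * 33) \<and>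
      selected q y g e N (insert ?c K) (fst t ''x'' 0) t) ?s"
      using t1(2) t2(2) t3(2,3) by (intro wpI) auto
    then show ?thesis
      using True h read unfolding p_check_def by (simp del: wp_Seq add: wp_Seq[of "IAsg ''m'' _"], elim wp_mono) simp
  qed
qed

definition p_select :: com where
  "p_select = Seq (IAsg ''x'' (IConst 1)) (for_loop ''k'' ''V'' p_check)"

lemma p_select_wp:
  fixes s :: state and y :: "nat \<Rightarrow> nat \<Rightarrow> real"
  assumes N: "fst s ''N'' 0 = int N" "fst s ''q'' 0 = int q"
    and h: "fst s ''h'' 0 = int N * (4 * int M + 2)" "fst s ''M'' 0 = int M"
      "fst s ''D'' 0 = 4 * int M + 2" "fst s ''V'' 0 = 2 * int M + 1"
    and T: "table_upto e (int M) N (fst s ''T'')" and e: "\<And>i. i < N \<Longrightarrow> fst s ''e'' (int i) = e i"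
    and M: "\<And>I. I \<subseteq> {..<N} \<Longrightarrow> \<bar>sum e I\<bar> \<le> int M"
    and g: "snd s ''g'' 0 = g" "fst s ''found'' 0 = 0"
    and y: "\<And>i j. i < N \<Longrightarrow> j < q \<Longrightarrow> snd s ''y'' (int (i * q + j)) = y i j"
  shows "wp p_select (\<lambda>m t. m \<le> 12 + (2 * M + 1) * (112 + N * 69 + q * (39 + N * 33)) \<and>
    selected q y g e N {- int M..int M} (fst t ''x'' 0) t) s"
proof -
  let ?K = "\<lambda>k. (\<lambda>l. int l - int M) ` {..<k}"
  let ?s = "iupd ''x'' 0 1 s"
  have "wp (for_loop ''k'' ''V'' p_check) (\<lambda>m t. m \<le> 9 + (2 * M + 1) * ((100 + N * 69 + q * (39 + N * 33)) + 12) \<and>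
    selected q y g e N (?K (2 * M + 1)) (fst t ''x'' 0) t) ?s"
  proof (rule for_loop_wp[where I = "\<lambda>k t. selected q y g e N (?K k) (fst t ''x'' 0) t"])
    show "selected q y g e N (?K 0) (fst (iupd ''k'' 0 0 ?s) ''x'' 0) (iupd ''k'' 0 0 ?s)"
      using g by (simp add: selected_def)
  next
    fix k and t :: state
    assume k: "k < 2 * M + 1" "fst t ''k'' 0 = int k"
      and f: "\<And>x. x \<notin> insert ''k'' (iwrites p_check) \<Longrightarrow> fst t x = fst ?s x"
        "\<And>x. x \<notin> rwrites p_check \<Longrightarrow> snd t x = snd ?s x"
      and I: "selected q y g e N (?K k) (fst t ''x'' 0) t"
    have "wp p_check (\<lambda>m t. m \<le> 100 + N * 69 + q * (39 + N * 33) \<and>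
      selected q y g e N (insert (int k - int M) (?K k)) (fst t ''x'' 0) t) t"
      by (rule p_check_wp) (use assms k I in \<open>simp_all add: f\<close>)
    moreover have "selected q y g e N K (fst (iupd ''k'' 0 v u) ''x'' 0) (iupd ''k'' 0 v u) =
      selected q y g e N K (fst u ''x'' 0) u" for K v u
      by (simp add: selected_def)
    ultimately show "wp p_check (\<lambda>m u. m \<le> 100 + N * 69 + q * (39 + N * 33) \<and>
        selected q y g e N (?K (Suc k)) (fst (iupd ''k'' 0 (int k + 1) u) ''x'' 0) (iupd ''k'' 0 (int k + 1) u)) t"
      by (simp add: lessThan_Suc)
  qed (use h in simp_all)
  moreover have "?K (2 * M + 1) = {- int M..int M}"
  proof (intro equalityI subsetI)
    fix c assume "c \<in> {- int M..int M}"
    then show "c \<in> ?K (2 * M + 1)" by (intro image_eqI[of _ _ "nat (c + int M)"]) auto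
  qed auto
  ultimately show ?thesis unfolding p_select_def by (simp, elim wp_mono) (simp add: algebra_simps)
qed

section \<open>Correctness and running time\<close>

lemma sum_code_bound:
  fixes Y :: "nat \<Rightarrow> nat \<Rightarrow> int"
  assumes "\<And>i j. i < N \<Longrightarrow> j < q \<Longrightarrow> \<bar>Y i j\<bar> \<le> B" "I \<subseteq> {..<N}" "j < q"
  shows "\<bar>\<Sum>i\<in>I. Y i j\<bar> \<le> B * int N"
proof -
  have "\<bar>\<Sum>i\<in>I. Y i j\<bar> \<le> (\<Sum>i\<in>I. \<bar>Y i j\<bar>)" by (rule sum_abs)
  also have "\<dots> \<le> (\<Sum>i\<in>I. B)" using assms by (intro sum_mono) auto
  also have "\<dots> \<le> B * int N"
  \<comment> \<open>\<open>B\<close> is seen to be nonnegative through an actual entry, which exists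
    for N > 0; otherwise \<open>I\<close> is empty.\<close>
  proof (cases "N = 0")
    case True
    then show ?thesis using assms(2) by simp
  next
    case False
    then have "0 \<le> B" using assms(1)[of 0 j] assms(3) by linarith
    moreover have "card I \<le> N" using card_mono[OF _ assms(2)] by simp
    ultimately show ?thesis by (simp add: mult.commute mult_left_mono)
  qed
  finally show ?thesis .
qed

lemma sum_code:
  fixes Y :: "nat \<Rightarrow> nat \<Rightarrow> int"
  assumes "I \<subseteq> {..<N}" "\<And>i. i < N \<Longrightarrow> e i = (\<Sum>j<q. Y i j * W ^ j)"
  shows "sum e I = (\<Sum>j<q. (\<Sum>i\<in>I. Y i j) * W ^ j)"
proof -
  have "sum e I = (\<Sum>i\<in>I. \<Sum>j<q. Y i j * W ^ j)" using assms by (intro sum.cong) auto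
  also have "\<dots> = (\<Sum>j<q. \<Sum>i\<in>I. Y i j * W ^ j)" by (rule sum.swap)
  finally show ?thesis by (simp add: sum_distrib_right)
qed

text \<open>The difference of the two codes has the differences of column sums as digits, at most
  2BN in absolute value. By \<open>digits_zero\<close>, equal codes force equal column sums.\<close>

lemma sq_norm_eq:
  fixes Y :: "nat \<Rightarrow> nat \<Rightarrow> int"
  assumes e: "\<And>i. i < N \<Longrightarrow> e i = (\<Sum>j<q. Y i j * (2 * B * int N + 1) ^ j)"
    and B: "\<And>i j. i < N \<Longrightarrow> j < q \<Longrightarrow> \<bar>Y i j\<bar> \<le> B"
    and y: "\<And>i j. i < N \<Longrightarrow> j < q \<Longrightarrow> y i j = real_of_int (Y i j)"
    and I: "I \<subseteq> {..<N}" "J \<subseteq> {..<N}" "sum e I = sum e J"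
  shows "sq_norm q y I = sq_norm q y J"
proof -
  have eq: "(\<Sum>i\<in>I. Y i j) - (\<Sum>i\<in>J. Y i j) = 0" if "j < q" for j
  proof (rule digits_zero[OF _ _ that, where W = "2 * B * int N + 1"])
    show "\<bar>(\<Sum>i\<in>I. Y i j) - (\<Sum>i\<in>J. Y i j)\<bar> < 2 * B * int N + 1" if "j < q" for j
      using sum_code_bound[of N q Y B I j] sum_code_bound[of N q Y B J j] B I that by force
    show "(\<Sum>j<q. ((\<Sum>i\<in>I. Y i j) - (\<Sum>i\<in>J. Y i j)) * (2 * B * int N + 1) ^ j) = 0"
      using I sum_code[OF I(1) e] sum_code[OF I(2) e] by (simp add: left_diff_distrib sum_subtractf)
  qed
  have "(\<Sum>i\<in>K. y i j) = real_of_int (\<Sum>i\<in>K. Y i j)" if "K \<subseteq> {..<N}" "j < q" for K j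
    using that y by (auto intro!: sum.cong)
  then have "(\<Sum>i\<in>I. y i j) = (\<Sum>i\<in>J. y i j)" if "j < q" for j
    using eq[OF that] I that by (metis eq_iff_diff_eq_0)
  then show ?thesis unfolding sq_norm_def by (auto intro!: sum.cong)
qed

text \<open>Distinctness makes indexing injective, so index sets and the sets of vectors they name
  agree in cardinality and coordinate sums.\<close>

lemma mcsv_feasible_image:
  assumes "distinct ys" "I \<subseteq> {..<length ys}"
  shows "card ((!) ys ` I) = card I"
    and "mcsv_feasible q \<alpha> (set ys) ((!) ys ` I) \<longleftrightarrow> I \<noteq> {} \<and>
      1 / real (card I) * sq_norm q (\<lambda>i j. ys ! i ! j) I \<le>
      \<alpha> * (1 / real (length ys)) * sq_norm q (\<lambda>i j. ys ! i ! j) {..<length ys}"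
proof -
  have inj: "inj_on ((!) ys) J" if "J \<subseteq> {..<length ys}" for J
    using assms(1) that by (intro inj_onI) (metis lessThan_iff nth_eq_iff_index_eq subsetD)
  then show card: "card ((!) ys ` I) = card I" using assms(2) by (intro card_image)
  have norm: "(sum_norm q ((!) ys ` J))\<^sup>2 = sq_norm q (\<lambda>i j. ys ! i ! j) J" if "J \<subseteq> {..<length ys}" for J
    unfolding sum_norm_def sq_norm_def L2_set_def
    by (simp add: sum_nonneg sum.reindex[OF inj[OF that]])
  have set: "set ys = (!) ys ` {..<length ys}" by (auto simp: set_conv_nth)
  show "mcsv_feasible q \<alpha> (set ys) ((!) ys ` I) \<longleftrightarrow> I \<noteq> {} \<and>
      1 / real (card I) * sq_norm q (\<lambda>i j. ys ! i ! j) I \<le>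
      \<alpha> * (1 / real (length ys)) * sq_norm q (\<lambda>i j. ys ! i ! j) {..<length ys}"
    unfolding mcsv_feasible_def card using assms norm norm[of "{..<length ys}"]
    by (auto simp: distinct_card simp flip: set)
qed

text \<open>One representative per code is enough: for a feasible set with code \<open>c\<close>,
  \<open>best_set\<close> at \<open>c\<close> has the same norm and at least the same cardinality,
  so its quotient is no larger and it is feasible too.\<close>

lemma selected_mcsv_answer:
  fixes Y :: "nat \<Rightarrow> nat \<Rightarrow> int" and ys :: "real list list"
  defines "N \<equiv> length ys"
  assumes dist: "distinct ys"
    and e: "\<And>i. i < N \<Longrightarrow> e i = (\<Sum>j<q. Y i j * (2 * B * int N + 1) ^ j)"
    and B: "\<And>i j. i < N \<Longrightarrow> j < q \<Longrightarrow> \<bar>Y i j\<bar> \<le> B"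
    and y: "\<And>i j. i < N \<Longrightarrow> j < q \<Longrightarrow> ys ! i ! j = real_of_int (Y i j)"
    and M: "\<And>I. I \<subseteq> {..<N} \<Longrightarrow> \<bar>sum e I\<bar> \<le> M"
    and sel: "selected q (\<lambda>i j. ys ! i ! j)
      (\<alpha> * (1 / real N) * sq_norm q (\<lambda>i j. ys ! i ! j) {..<N}) e N {- M..M} m s"
  shows "mcsv_answer q \<alpha> (set ys) (mcsv_output ys s)"
proof -
  let ?y = "\<lambda>i j. ys ! i ! j"
  let ?g = "\<alpha> * (1 / real N) * sq_norm q ?y {..<N}"
  have best_set: "int (card (best_set e N c)) = best e N c - 1" "sum e (best_set e N c) = c"
      "best_set e N c \<subseteq> {..<N}" "best_set e N c \<noteq> {}" if "1 < best e N c" for c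
    using best_set_correct[of e N c] best_set_subset[of e N c] that by auto
  have feas: "mcsv_feasible q \<alpha> (set ys) ((!) ys ` best_set e N c)" if "admissible q ?y ?g e N c" for c
  proof -
    have c: "1 < best e N c" using that by (simp add: admissible_def)
    from best_set(1)[OF this] have "real_of_int (best e N c - 1) = real (card (best_set e N c))"
      by (metis of_int_of_nat_eq)
    then show ?thesis
      using that best_set(3,4)[OF c] by (simp add: mcsv_feasible_image dist admissible_def flip: N_def)
  qed
  \<comment> \<open>Strictness comes from the shift by one; for m = 1 it rules out every feasible
    set.\<close>
  have bound: "int (card C) < m" if C: "mcsv_feasible q \<alpha> (set ys) C" for C
  proof -
    define I where "I = {i. i < N \<and> ys ! i \<in> C}"
    have I: "I \<subseteq> {..<N}" by (auto simp: I_def)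
    then have fin: "finite I" using finite_subset by blast
    have CI: "C = (!) ys ` I"
      using C by (auto simp: I_def N_def mcsv_feasible_def in_set_conv_nth subset_iff image_iff)
    have ne: "I \<noteq> {}" "1 / real (card I) * sq_norm q ?y I \<le> ?g"
      using C mcsv_feasible_image(2)[OF dist, of I q \<alpha>] I unfolding CI N_def by auto
    let ?c = "sum e I"
    have best: "int (card I) + 1 \<le> best e N ?c" using I by (rule best_ge)
    have pos: "0 < card I" using ne fin by (simp add: card_gt_0_iff)
    have "sq_norm q ?y (best_set e N ?c) = sq_norm q ?y I"
      using best_set(2,3)[of ?c] best pos by (intro sq_norm_eq[OF e B y _ I]) auto
    moreover have "1 / real_of_int (best e N ?c - 1) * sq_norm q ?y I \<le> 1 / real (card I) * sq_norm q ?y I"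
      using best pos by (intro mult_right_mono frac_le) (auto simp: sq_norm_def sum_nonneg)
    ultimately have "admissible q ?y ?g e N ?c"
      using best pos ne by (auto simp: admissible_def)
    moreover have "?c \<in> {- M..M}" using M[OF I] by auto
    ultimately have "best e N ?c \<le> m" using sel by (auto simp: selected_def)
    then show ?thesis using best I by (simp add: CI mcsv_feasible_image(1)[OF dist] N_def)
  qed
  show ?thesis
  proof (cases "fst s ''found'' 0 = 0")
    case True
    then have "m = 1" using sel by (simp add: selected_def)
    have False if C: "mcsv_feasible q \<alpha> (set ys) C" for C
    proof -
      have "finite C" "C \<noteq> {}" using C finite_subset by (auto simp: mcsv_feasible_def)
      then show False using bound[OF C] \<open>m = 1\<close> by simp
    qed
    then show ?thesis using True by (auto simp: mcsv_output_def)
  next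
    case False
    then obtain c where c: "admissible q ?y ?g e N c" "best e N c = m"
      "\<And>i. i < N \<Longrightarrow> fst s ''C'' (int i) = of_bool (i \<in> best_set e N c)"
      using sel by (auto simp: selected_def)
    have t: "1 < best e N c" using c(1) by (simp add: admissible_def)
    have "{ys ! i |i. i < length ys \<and> fst s ''C'' (int i) \<noteq> 0} = (!) ys ` best_set e N c"
      using c(3) best_set(3)[OF t] by (force simp: N_def)
    moreover have "mcsv_optimal q \<alpha> (set ys) ((!) ys ` best_set e N c)"
      using feas[OF c(1)] bound best_set(1,3)[OF t] c(2)
      by (fastforce simp: mcsv_optimal_def mcsv_feasible_image(1)[OF dist] N_def)
    ultimately show ?thesis using False by (simp add: mcsv_output_def)
  qed
qed

section \<open>The assembled program and its total cost\<close>

definition mcsv_program :: com where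
  "mcsv_program = Seq p_size (Seq p_bound (Seq p_base (Seq p_pow (Seq p_code
     (Seq p_table (Seq p_total p_select))))))"

text \<open>Every term is a constant times some x * y * z with x \<le> q, y \<le> N, z \<le> P,
  after 2M + 1 \<le> 3P. The constants add up to 1480; 2000 is a round bound.\<close>

lemma mcsv_program_cost:
  fixes q N b B W M :: nat
  assumes "1 \<le> q" "1 \<le> N" "B \<le> b"
    and "W = 2 * B * N + 1" "M = W ^ q"
  shows "(12 + N * 19) + (9 + (N * q) * (b * 22 + 28)) + (12 + N * 22) + (12 + q * (W * 20 + 40)) +
    (12 + N * (21 + q * (39 * B + 37))) + (36 + N * (28 + (2 * M + 1) * 72)) +
    (36 + N * 16 + q * (39 + N * 33)) + (12 + (2 * M + 1) * (112 + N * 69 + q * (39 + N * 33)))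
    \<le> 2000 * (q * N * (2 * b * N + 1) ^ q)"
proof -
  define P where "P = (2 * b * N + 1) ^ q"
  define X where "X = q * N * P"
  have "W \<le> 2 * b * N + 1" using assms by simp
  then have MP: "M \<le> P" unfolding P_def assms(5) by (rule power_mono) simp
  \<comment> \<open>For q \<ge> 1 the base is bounded by its power, so the unary work in
    \<open>b\<close>, \<open>B\<close> and \<open>W\<close> is absorbed by \<open>P\<close>.\<close>
  have "(2 * b * N + 1) ^ 1 \<le> P" unfolding P_def using assms(1) by (intro power_increasing) auto
  then have "2 * b * N + 1 \<le> P" by simp
  moreover have "b \<le> b * N" using assms by simp
  ultimately have bP: "b \<le> P" "1 \<le> P" "W \<le> P" "B \<le> P" using \<open>W \<le> _\<close> assms(3) by linarith+
  have Q: "2 * M + 1 \<le> 3 * P" using MP bP by simp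
  have le: "x * y * z \<le> X" if "x \<le> q" "y \<le> N" "z \<le> P" for x y z
    unfolding X_def using that by (intro mult_le_mono)
  have "1 \<le> X" "N \<le> X" "q \<le> X" "N * q \<le> X" "N * q * b \<le> X" "q * W \<le> X" "N * q * B \<le> X"
    "N * P \<le> X" "P \<le> X" "q * P \<le> X" "N * q * P \<le> X"
    using le[of 1 1 1] le[of 1 N 1] le[of q 1 1] le[of q N 1] le[of q N b] le[of q 1 W] le[of q N B]
      le[of 1 N P] le[of 1 1 P] le[of q 1 P] le[of q N P] assms(1,2) bP
    by (simp_all add: mult.commute mult.left_commute)
  moreover have "N * (2 * M + 1) \<le> 3 * (N * P)" using mult_le_mono2[OF Q, of N] by simp
  moreover have "(2 * M + 1) * (112 + N * 69 + q * (39 + N * 33)) \<le> 3 * P * (112 + N * 69 + q * (39 + N * 33))"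
    by (rule mult_le_mono1[OF Q])
  moreover have "3 * P * (112 + N * 69 + q * (39 + N * 33)) = 336 * P + 207 * (N * P) + 117 * (q * P) + 99 * (N * q * P)"
    by (simp add: algebra_simps)
  moreover have "(12 + N * 19) + (9 + (N * q) * (b * 22 + 28)) + (12 + N * 22) + (12 + q * (W * 20 + 40)) +
    (12 + N * (21 + q * (39 * B + 37))) + (36 + N * (28 + (2 * M + 1) * 72)) +
    (36 + N * 16 + q * (39 + N * 33)) + 12 =
    141 + 106 * N + 79 * q + 98 * (N * q) + 22 * (N * q * b) + 20 * (q * W) + 39 * (N * q * B) + 72 * (N * (2 * M + 1))"
    by (simp add: algebra_simps)
  ultimately have "(12 + N * 19) + (9 + (N * q) * (b * 22 + 28)) + (12 + N * 22) + (12 + q * (W * 20 + 40)) +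
    (12 + N * (21 + q * (39 * B + 37))) + (36 + N * (28 + (2 * M + 1) * 72)) +
    (36 + N * 16 + q * (39 + N * 33)) + (12 + (2 * M + 1) * (112 + N * 69 + q * (39 + N * 33))) \<le> 2000 * X"
    by linarith
  then show ?thesis by (simp add: X_def P_def)
qed

lemma writes_program [simp]:
  "iwrites p_size = {''L'', ''i''}" "rwrites p_size = {}"
  "iwrites p_bound = {''k'', ''B''}" "rwrites p_bound = {}"
  "iwrites p_base = {''W'', ''i''}" "rwrites p_base = {}"
  "iwrites p_pow = {''w'', ''j'', ''a'', ''k''}" "rwrites p_pow = {}"
  "iwrites p_code = {''p'', ''i'', ''j'', ''z'', ''e''}" "rwrites p_code = {}"
  "iwrites p_table = {''T'', ''h'', ''M'', ''V'', ''D'', ''i'', ''k'', ''c''}" "rwrites p_table = {}"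
  by (auto simp: p_size_def p_bound_def p_base_def p_pow_def p_code_def p_table_def)

lemma mcsv_program_correct:
  assumes q: "1 \<le> q" and N: "1 \<le> length ys" and dist: "distinct ys"
    and ys: "\<forall>y\<in>set ys. \<forall>j<q. y ! j \<in> \<int> \<and> \<bar>y ! j\<bar> \<le> real b"
  shows "wp mcsv_program (\<lambda>n s. n \<le> 2000 * (q * length ys * (2 * b * length ys + 1) ^ q) \<and>
    mcsv_answer q \<alpha> (set ys) (mcsv_output ys s)) (mcsv_input q \<alpha> ys)"
proof -
  let ?N = "length ys" and ?y = "\<lambda>i j. ys ! i ! j"
  define s0 where "s0 = mcsv_input q \<alpha> ys"
  define Y where "Y = (\<lambda>i j. \<lfloor>ys ! i ! j\<rfloor>)"
  have Y: "ys ! i ! j = real_of_int (Y i j)" "\<bar>Y i j\<bar> \<le> int b" if "i < ?N" "j < q" for i j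
  proof -
    have "ys ! i ! j \<in> \<int>" "\<bar>ys ! i ! j\<bar> \<le> real b" using ys that by auto
    then show "ys ! i ! j = real_of_int (Y i j)" by (simp add: Y_def)
    with \<open>\<bar>ys ! i ! j\<bar> \<le> real b\<close> show "\<bar>Y i j\<bar> \<le> int b" by linarith
  qed
  have i0: "fst s0 ''N'' 0 = int ?N" "fst s0 ''q'' 0 = int q" "snd s0 ''alpha'' 0 = \<alpha>"
    "fst s0 ''B'' 0 = 0" "fst s0 ''e'' = (\<lambda>_. 0)" "fst s0 ''T'' = (\<lambda>_. 0)" "fst s0 ''found'' 0 = 0"
    by (simp_all add: s0_def mcsv_input_def)
  have y0: "snd s0 ''y'' (int k) = ys ! (k div q) ! (k mod q)" if "k < ?N * q" for k
    using that by (simp add: s0_def mcsv_input_def flip: of_nat_mult)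
  have ij: "snd s0 ''y'' (int (i * q + j)) = ys ! i ! j" if "i < ?N" "j < q" for i j
  proof -
    have "i * q + j < ?N * q" using that mult_le_mono1[of "Suc i" ?N q] by simp
    then show ?thesis using y0[of "i * q + j"] that by simp
  qed
  have dm: "k div q < ?N" "k mod q < q" if "k < ?N * q" for k
    using that q by (simp_all add: less_mult_imp_div_less)

  from p_size_wp[OF i0(1,2)] obtain n1 s1 where r1: "runs p_size s0 n1 s1" "n1 \<le> 12 + ?N * 19"
    and L: "fst s1 ''L'' 0 = int (?N * q)" by (elim wpE) blast
  note f1 = runs_iframe[OF r1(1)] runs_rframe[OF r1(1)]
  have "wp p_bound (\<lambda>m t. m \<le> 9 + (?N * q) * (b * 22 + 28) \<and> 0 \<le> fst t ''B'' 0 \<and> fst t ''B'' 0 \<le> int b \<and>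
    (\<forall>k<?N * q. \<bar>Y (k div q) (k mod q)\<bar> \<le> fst t ''B'' 0)) s1"
    using L i0 y0 Y dm by (intro p_bound_wp) (simp_all add: f1)
  then obtain n2 s2 where r2: "runs p_bound s1 n2 s2" "n2 \<le> 9 + (?N * q) * (b * 22 + 28)"
    and B0: "0 \<le> fst s2 ''B'' 0" "fst s2 ''B'' 0 \<le> int b"
      "\<forall>k<?N * q. \<bar>Y (k div q) (k mod q)\<bar> \<le> fst s2 ''B'' 0" by (elim wpE) blast
  note f2 = runs_iframe[OF r2(1)] runs_rframe[OF r2(1)]
  \<comment> \<open>From here on the bound found by the program is used; \<open>B \<le> b\<close>
    later transfers costs in \<open>W\<close> to the base 2bN + 1.\<close>
  define B where "B = nat (fst s2 ''B'' 0)"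
  have B: "fst s2 ''B'' 0 = int B" "B \<le> b" using B0 by (auto simp: B_def)
  have YB: "\<bar>Y i j\<bar> \<le> int B" if "i < ?N" "j < q" for i j
  proof -
    have "i * q + j < ?N * q" using that mult_le_mono1[of "Suc i" ?N q] by simp
    then show ?thesis using B0(3) that by (force simp: B(1))
  qed
  have "wp p_base (\<lambda>m t. m \<le> 12 + ?N * 22 \<and> fst t ''W'' 0 = int (2 * B * ?N + 1)) s2"
    using i0 B by (intro p_base_wp) (simp_all add: f1 f2)
  then obtain n3 s3 where r3: "runs p_base s2 n3 s3" "n3 \<le> 12 + ?N * 22"
    and W: "fst s3 ''W'' 0 = int (2 * B * ?N + 1)" by (elim wpE) blast
  note f3 = runs_iframe[OF r3(1)] runs_rframe[OF r3(1)]
  define W where "W = 2 * B * ?N + 1"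
  define M where "M = W ^ q"
  have "wp p_pow (\<lambda>m t. m \<le> 12 + q * (W * 20 + 40) \<and> (\<forall>j\<le>q. fst t ''w'' (int j) = int W ^ j)) s3"
    using i0 W by (intro p_pow_wp) (simp_all add: f1 f2 f3 W_def)
  then obtain n4 s4 where r4: "runs p_pow s3 n4 s4" "n4 \<le> 12 + q * (W * 20 + 40)"
    and w: "\<And>j. j \<le> q \<Longrightarrow> fst s4 ''w'' (int j) = int W ^ j" by (elim wpE) blast
  note f4 = runs_iframe[OF r4(1)] runs_rframe[OF r4(1)]
  have "wp p_code (\<lambda>m t. m \<le> 12 + ?N * (21 + q * (39 * B + 37)) \<and>
    (\<forall>i<?N. fst t ''e'' (int i) = (\<Sum>j<q. Y i j * int W ^ j))) s4"
    using i0 w ij Y YB by (intro p_code_wp) (simp_all add: f1 f2 f3 f4 del: of_nat_add of_nat_mult)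
  then obtain n5 s5 where r5: "runs p_code s4 n5 s5" "n5 \<le> 12 + ?N * (21 + q * (39 * B + 37))"
    and e: "\<And>i. i < ?N \<Longrightarrow> fst s5 ''e'' (int i) = (\<Sum>j<q. Y i j * int W ^ j)" by (elim wpE) blast
  note f5 = runs_iframe[OF r5(1)] runs_rframe[OF r5(1)]
  define e where "e = (\<lambda>i. \<Sum>j<q. Y i j * int W ^ j)"
  \<comment> \<open>Column sums are at most BN, hence below \<open>W\<close>, so \<open>M\<close>
    bounds every code and the table covers all of them.\<close>
  have Mb: "\<bar>sum e I\<bar> \<le> int M" if "I \<subseteq> {..<?N}" for I
  proof -
    have "sum e I = (\<Sum>j<q. (\<Sum>i\<in>I. Y i j) * int W ^ j)"
      using that by (rule sum_code) (simp add: e_def)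
    moreover have "\<bar>\<Sum>i\<in>I. Y i j\<bar> < int W" if "j < q" for j
      using sum_code_bound[of ?N q Y "int B" I j, OF YB \<open>I \<subseteq> _\<close> that] by (simp add: W_def)
    then have "\<bar>\<Sum>j<q. (\<Sum>i\<in>I. Y i j) * int W ^ j\<bar> < int W ^ q" by (rule abs_digits_less)
    ultimately show ?thesis by (simp add: M_def)
  qed
  have "wp p_table (\<lambda>m t. m \<le> 36 + ?N * (28 + (2 * M + 1) * 72) \<and>
    table_upto e (int M) ?N (fst t ''T'') \<and> fst t ''h'' 0 = int ?N * (4 * int M + 2) \<and>
    fst t ''M'' 0 = int M \<and> fst t ''V'' 0 = 2 * int M + 1 \<and> fst t ''D'' 0 = 4 * int M + 2) s5"
    using i0 w[of q] e Mb by (intro p_table_wp) (simp_all add: f1 f2 f3 f4 f5 e_def M_def)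
  then obtain n6 s6 where r6: "runs p_table s5 n6 s6" "n6 \<le> 36 + ?N * (28 + (2 * M + 1) * 72)"
    and T: "table_upto e (int M) ?N (fst s6 ''T'')" "fst s6 ''h'' 0 = int ?N * (4 * int M + 2)"
      "fst s6 ''M'' 0 = int M" "fst s6 ''V'' 0 = 2 * int M + 1" "fst s6 ''D'' 0 = 4 * int M + 2"
    by (elim wpE) blast
  note f6 = runs_iframe[OF r6(1)] runs_rframe[OF r6(1)]
  have "wp p_total (\<lambda>m t. m \<le> 36 + ?N * 16 + q * (39 + ?N * 33) \<and>
    snd t ''g'' 0 = snd s6 ''alpha'' 0 * (1 / real ?N) *
      (\<Sum>j<q. (\<Sum>i<?N. snd s6 ''y'' (int (i * q + j)))\<^sup>2)) s6"
    using i0 by (intro p_total_wp) (simp_all add: f1 f2 f3 f4 f5 f6)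
  then obtain n7 s7 where r7: "runs p_total s6 n7 s7" "n7 \<le> 36 + ?N * 16 + q * (39 + ?N * 33)"
    and g: "snd s7 ''g'' 0 = snd s6 ''alpha'' 0 * (1 / real ?N) *
      (\<Sum>j<q. (\<Sum>i<?N. snd s6 ''y'' (int (i * q + j)))\<^sup>2)" by (elim wpE) blast
  note f7 = runs_iframe[OF r7(1)] runs_rframe[OF r7(1)]
  have g: "snd s7 ''g'' 0 = \<alpha> * (1 / real ?N) * sq_norm q ?y {..<?N}"
    unfolding g sq_norm_def using i0 ij by (simp add: f1 f2 f3 f4 f5 f6 del: of_nat_add of_nat_mult)
  have "wp p_select (\<lambda>m t. m \<le> 12 + (2 * M + 1) * (112 + ?N * 69 + q * (39 + ?N * 33)) \<and>
    selected q ?y (\<alpha> * (1 / real ?N) * sq_norm q ?y {..<?N}) e ?N {- int M..int M} (fst t ''x'' 0) t) s7"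
    using i0 T e Mb g ij
    by (intro p_select_wp) (simp_all add: f1 f2 f3 f4 f5 f6 f7 e_def del: of_nat_add of_nat_mult)
  then obtain n8 s8 where r8: "runs p_select s7 n8 s8" "n8 \<le> 12 + (2 * M + 1) * (112 + ?N * 69 + q * (39 + ?N * 33))"
    and sel: "selected q ?y (\<alpha> * (1 / real ?N) * sq_norm q ?y {..<?N}) e ?N {- int M..int M} (fst s8 ''x'' 0) s8"
    by (elim wpE) blast
  have "runs mcsv_program s0 (n1 + (n2 + (n3 + (n4 + (n5 + (n6 + (n7 + n8))))))) s8"
    unfolding mcsv_program_def by (rule runs.Seq r1 r2 r3 r4 r5 r6 r7 r8)+
  moreover have "n1 + (n2 + (n3 + (n4 + (n5 + (n6 + (n7 + n8)))))) \<le> 2000 * (q * ?N * (2 * b * ?N + 1) ^ q)"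
    using mcsv_program_cost[OF q N B(2) W_def M_def] r1(2) r2(2) r3(2) r4(2) r5(2) r6(2) r7(2) r8(2)
    by linarith
  moreover have "mcsv_answer q \<alpha> (set ys) (mcsv_output ys s8)"
    using dist YB Y Mb sel
    by (intro selected_mcsv_answer[where Y = Y and B = "int B" and e = e and M = "int M"])
      (auto simp: e_def W_def algebra_simps)
  ultimately show ?thesis unfolding s0_def by (blast intro: wpI)
qed

theorem theorem2:
  "\<exists>(P :: com) (K :: nat).
     \<forall>(q :: nat) (b :: nat) (ys :: real list list) (\<alpha> :: real).
       1 \<le> q \<and> 1 \<le> b \<and> 1 \<le> length ys \<and> distinct ys \<and> (\<forall>y\<in>set ys. length y = q) \<and>
       0 < \<alpha> \<and> \<alpha> < 1 \<and>
       (\<forall>y\<in>set ys. \<forall>j<q. y ! j \<in> \<int> \<and> \<bar>y ! j\<bar> \<le> real b) \<longrightarrow>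
       (\<exists>n s. runs P (mcsv_input q \<alpha> ys) n s \<and>
              mcsv_answer q \<alpha> (set ys) (mcsv_output ys s) \<and>
              n \<le> K * (q * length ys * (2 * b * length ys + 1) ^ q))"
  \<comment> \<open>The witnesses are \<open>mcsv_program\<close> and 2000, both independent of the
    input.\<close>
  using mcsv_program_correct unfolding wp_def by metis

end
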